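(* Let $K$ be a field of characteristic $0$ and let $(\rho_i)_{i\ge 0}$ be an essential continuous MacLane chain of valuations on $K[x]$, with $\rho_i=[\rho_{i-1};\chi_i,\beta_i]$ for all $i\ge 1$, and with stable value group $\Gamma_\infty$. If the sequence $(\beta_i)_{i\ge 1}$ is unbounded in $\Gamma_\infty$ (that is, it admits no upper bound in $\Gamma_\infty$), then $t_\infty=b_\infty=1$.
   Context: Valuations. A valuation $\nu$ on $K[x]$ is a map $\nu\colon K[x]\to\Lambda\cup\{\infty\}$ ($\Lambda$ a totally ordered abelian group) with $\nu(fg)=\nu(f)+\nu(g)$, $\nu(f+g)\ge\min\{\nu(f),\nu(g)\}$, whose restriction to $K$ is a valuation of the field $K$. Its value group $\Gamma_\nu$ is generated by the finite values of $\nu$; $(\Gamma_\nu)_{\mathbb Q}=\Gamma_\nu\otimes\mathbb Q$. For valuations, $\mu\le\nu$ means $\mu(f)\le\nu(f)$ for all $f\in K[x]$. MLV key polynomials. Let $\mathcal P_\alpha=\{g:\nu(g)\ge\alpha\}\supset\mathcal P_\alpha^+=\{g:\nu(g)>\alpha\}$, and let $\mathcal G_\nu=\bigoplus_{\alpha\in\Gamma_\nu}\mathcal P_\alpha/\mathcal P_\alpha^+$ be the graded algebra, with $\operatorname{in}_\nu g=g+\mathcal P_{\nu(g)}^+$ if $\nu(g)<\infty$, and $\operatorname{in}_\nu g=0$ otherwise. Write $h\mid_\nu g$ if $\operatorname{in}_\nu h$ divides $\operatorname{in}_\nu g$ in $\mathcal G_\nu$. A MacLane-Vaquié (MLV) key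 polynomial for $\nu$ is a monic $g\in K[x]$ such that $(\operatorname{in}_\nu g)\mathcal G_\nu$ is a non-zero prime ideal and $g\nmid_\nu f$ for every non-zero $f$ with $\deg f<\deg g$. The set of these is $\mathrm{KP}(\nu)$. Ordinary augmentation. If $\chi\in\mathrm{KP}(\rho)$ and $\beta>\rho(\chi)$ lies in an ordered group containing $\Gamma_\rho$, then $[\rho;\chi,\beta]$ is the valuation sending $f=\sum_{s}a_s\chi^s$ ($\deg a_s<\deg\chi$) to $\min_s\{\rho(a_s)+s\beta\}$. Continuous MacLane chains. Let $\rho_0$ be a valuation with $\mathrm{KP}(\rho_0)\ne\emptyset$. A continuous MacLane chain of stable degree $m$ is an infinite sequence of valuations (values in a common ordered abelian group) $\rho_i=[\rho_{i-1};\chi_i,\beta_i]$, $i\ge1$, with $\chi_i\in\mathrm{KP}(\rho_{i-1})$, $\beta_i>\rho_{i-1}(\chi_i)$ finite, $\deg\chi_i=m$ and $\chi_{i+1}\nmid_{\rho_i}\chi_i$ for all $i\ge 1$. It is known that $\Gamma_{\rho_i}=\Gamma_{\rho_1}$ for all $i\ge1$; this group is the stable value group $\Gamma_\infty$, and $\beta_i\in\Gamma_\infty$. A polynomial $f$ is stable if $\rho_i(f)$ is constant for $i$ large. Let $m_\infty$ be the minimal degree of a non-stable polynomial ($\infty$ if there are none). The chain is essential if $m<m_\infty<\infty$. In this case $\mathrm{KP}_\infty$, the set of MLV limit key polynomials of the chain, is the set of all monic non-stable polynomials of degree $m_\infty$. Invariants. For $b\ge0$, $\partial_b$ is the operator on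 $K[x]$ defined by $f(x+y)=\sum_{b\ge0}\partial_b(f)y^b$. For $\phi\in\mathrm{KP}_\infty$ and $i\ge1$ let $\phi=\sum_s a_{s,i}\chi_i^s$ ($\deg a_{s,i}<m$) be the $\chi_i$-expansion, and let $t_i(\phi)$ be the maximal $s$ with $\rho_i(a_{s,i}\chi_i^s)=\rho_i(\phi)$. The integers $t_i(\phi)$ are positive and constant for $i$ large; the eventual value $t_\infty$ (numerical character) does not depend on the choice of $\phi$. Let $\nu$ be any valuation on $K[x]$ with $\nu>\rho_i$ for all $i$. For non-constant $f$ with $\nu(f)<\infty$ put $\epsilon(f)=\max_{b\ge1}\frac{\nu(f)-\nu(\partial_b(f))}{b}\in(\Gamma_\nu)_{\mathbb Q}$ and let $I(f)$ be the set of $b\ge1$ attaining this maximum. It is known that there is a positive integer $b_\infty$, independent of $\nu$, with $I(\chi_j)=\{b_\infty\}$ for all $j$ large enough. *)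

theory Defs
  imports
    "HOL-Library.Extended"
    "HOL-Library.Extended_Nat"
    "HOL-Library.Poly_Mapping"
    "HOL-Computational_Algebra.Polynomial"
    "HOL-Computational_Algebra.Group_Closure"
    "HOL-Algebra.Divisibility"
    "HOL-Algebra.QuotRing"
begin

section \<open>Natural multiples and the divisible hull of an ordered abelian group\<close>

definition nmult :: "nat \<Rightarrow> 'v::comm_monoid_add \<Rightarrow> 'v" where
  "nmult n a = (\<Sum>_<n. a)"

lemma nmult_0 [simp]: "nmult 0 a = 0"
  by (simp add: nmult_def)

lemma nmult_Suc [simp]: "nmult (Suc n) a = nmult n a + a"
  by (simp add: nmult_def)

lemma nmult_nmult: "nmult m (nmult n a) = nmult (m * n) a"
proof (induction m)
  case (Suc m)
  have "nmult (k + l) a = nmult k a + nmult l a" for k l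
    by (induction k) (simp_all add: ac_simps)
  with Suc show ?case by (simp add: ac_simps)
qed simp

lemma nmult_less_mono:
  fixes a b :: "'v::linordered_ab_group_add"
  assumes "n > 0" "a < b"
  shows "nmult n a < nmult n b"
  using \<open>n > 0\<close>
proof (induction n rule: nat_induct_non_zero)
  case (Suc n)
  then show ?case using \<open>a < b\<close> by (simp add: add_strict_mono)
qed (use \<open>a < b\<close> in simp)

lemma nmult_le_iff:
  fixes a b :: "'v::linordered_ab_group_add"
  assumes "n > 0"
  shows "nmult n a \<le> nmult n b \<longleftrightarrow> a \<le> b"
  using nmult_less_mono[OF assms] by (metis linorder_neqE linorder_not_less order.strict_implies_order order_refl)

lemma nmult_eq_iff:
  fixes a b :: "'v::linordered_ab_group_add"
  assumes "n > 0"
  shows "nmult n a = nmult n b \<longleftrightarrow> a = b"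
  using nmult_le_iff[OF assms] by (metis order_antisym order_refl)

text \<open>The ordered set underlying \<open>\<Lambda> \<otimes> \<rat>\<close>: since \<open>\<Lambda>\<close> is torsion free, every element of
  \<open>\<Lambda> \<otimes> \<rat>\<close> is a fraction \<open>a / n\<close> with \<open>n\<close> a positive integer.\<close>

definition hullrel :: "'v::linordered_ab_group_add \<times> nat \<Rightarrow> 'v \<times> nat \<Rightarrow> bool" where
  "hullrel x y \<longleftrightarrow> snd x > 0 \<and> snd y > 0 \<and> nmult (snd y) (fst x) = nmult (snd x) (fst y)"

lemma part_equivp_hullrel: "part_equivp hullrel"
proof (rule part_equivpI)
  show "\<exists>x. hullrel x x"
    by (rule exI[of _ "(0, 1)"]) (simp add: hullrel_def)
  show "symp hullrel"
    by (auto simp: symp_def hullrel_def)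
  show "transp hullrel"
  proof (rule transpI)
    fix x y z :: "'v::linordered_ab_group_add \<times> nat"
    assume xy: "hullrel x y" and yz: "hullrel y z"
    have "nmult (snd y) (nmult (snd z) (fst x)) = nmult (snd z) (nmult (snd y) (fst x))"
      by (simp add: nmult_nmult mult.commute)
    also have "\<dots> = nmult (snd x) (nmult (snd z) (fst y))"
      using xy by (simp add: hullrel_def nmult_nmult mult.commute)
    also have "\<dots> = nmult (snd x) (nmult (snd y) (fst z))"
      using yz by (simp add: hullrel_def)
    also have "\<dots> = nmult (snd y) (nmult (snd x) (fst z))"
      by (simp add: nmult_nmult mult.commute)
    finally show "hullrel x z"
      using xy yz by (simp add: hullrel_def nmult_eq_iff)
  qed
qed

quotient_type (overloaded) 'v rat_hull = "'v::linordered_ab_group_add \<times> nat" / partial: hullrel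
  by (rule part_equivp_hullrel)

text \<open>\<open>hull_frac a n\<close> is \<open>a / n\<close> for \<open>n > 0\<close>, and \<open>0\<close> for \<open>n = 0\<close>.\<close>

lift_definition hull_frac :: "'v::linordered_ab_group_add \<Rightarrow> nat \<Rightarrow> 'v rat_hull" is
  "\<lambda>a n. if n = 0 then (0, 1) else (a, n)"
  by (simp add: hullrel_def)

instantiation rat_hull :: (linordered_ab_group_add) linorder
begin

lift_definition less_eq_rat_hull :: "'a rat_hull \<Rightarrow> 'a rat_hull \<Rightarrow> bool" is
  "\<lambda>x y. nmult (snd y) (fst x) \<le> nmult (snd x) (fst y)"
proof -
  fix x x' y y' :: "'a \<times> nat"
  assume x: "hullrel x x'" and y: "hullrel y y'"
  let ?c = "snd x' * snd y'" and ?d = "snd x * snd y"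
  have "nmult (snd y) (fst x) \<le> nmult (snd x) (fst y)
      \<longleftrightarrow> nmult ?c (nmult (snd y) (fst x)) \<le> nmult ?c (nmult (snd x) (fst y))"
    using x y by (subst nmult_le_iff) (auto simp: hullrel_def)
  also have "nmult ?c (nmult (snd y) (fst x)) = nmult (snd y * snd y') (nmult (snd x') (fst x))"
    by (simp add: nmult_nmult ac_simps)
  also have "\<dots> = nmult ?d (nmult (snd y') (fst x'))"
    using x by (simp add: hullrel_def nmult_nmult ac_simps)
  also have "nmult ?c (nmult (snd x) (fst y)) = nmult (snd x * snd x') (nmult (snd y') (fst y))"
    by (simp add: nmult_nmult ac_simps)
  also have "\<dots> = nmult ?d (nmult (snd x') (fst y'))"
    using y by (simp add: hullrel_def nmult_nmult ac_simps)
  also have "nmult ?d (nmult (snd y') (fst x')) \<le> nmult ?d (nmult (snd x') (fst y'))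
      \<longleftrightarrow> nmult (snd y') (fst x') \<le> nmult (snd x') (fst y')"
    using x y by (subst nmult_le_iff) (auto simp: hullrel_def)
  finally show "(nmult (snd y) (fst x) \<le> nmult (snd x) (fst y)) =
      (nmult (snd y') (fst x') \<le> nmult (snd x') (fst y'))" .
qed

definition less_rat_hull :: "'a rat_hull \<Rightarrow> 'a rat_hull \<Rightarrow> bool" where
  "less_rat_hull x y \<longleftrightarrow> x \<le> y \<and> \<not> y \<le> x"

instance
proof
  fix x y z :: "'a rat_hull"
  show "(x < y) = (x \<le> y \<and> \<not> y \<le> x)"
    by (simp add: less_rat_hull_def)
  show "x \<le> x"
    by transfer simp
  show "x \<le> y \<or> y \<le> x"
    by transfer (rule linear)
  show "x = y" if "x \<le> y" "y \<le> x"
    using that by transfer (simp add: hullrel_def)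
  show "x \<le> z" if "x \<le> y" "y \<le> z"
    using that
  proof transfer
    fix x y z :: "'a \<times> nat"
    assume pos: "hullrel x x" "hullrel y y" "hullrel z z"
    assume xy: "nmult (snd y) (fst x) \<le> nmult (snd x) (fst y)"
      and yz: "nmult (snd z) (fst y) \<le> nmult (snd y) (fst z)"
    have "nmult (snd y) (nmult (snd z) (fst x)) = nmult (snd z) (nmult (snd y) (fst x))"
      by (simp add: nmult_nmult ac_simps)
    also have "\<dots> \<le> nmult (snd z) (nmult (snd x) (fst y))"
      using xy pos by (simp add: hullrel_def nmult_le_iff)
    also have "\<dots> = nmult (snd x) (nmult (snd z) (fst y))"
      by (simp add: nmult_nmult ac_simps)
    also have "\<dots> \<le> nmult (snd x) (nmult (snd y) (fst z))"
      using yz pos by (simp add: hullrel_def nmult_le_iff)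
    also have "\<dots> = nmult (snd y) (nmult (snd x) (fst z))"
      by (simp add: nmult_nmult ac_simps)
    finally show "nmult (snd z) (fst x) \<le> nmult (snd x) (fst z)"
      using pos by (simp add: hullrel_def nmult_le_iff)
  qed
qed

end

lemma hull_frac_le_iff:
  "m > 0 \<Longrightarrow> n > 0 \<Longrightarrow> hull_frac a m \<le> hull_frac b n \<longleftrightarrow> nmult n a \<le> nmult m b"
  by transfer simp


section \<open>Valuations on \<open>K[x]\<close>\<close>

text \<open>\<open>\<Lambda> \<union> {\<infinity>}\<close> is the part of the type \<open>'v extended\<close> other than \<open>Minf\<close>. Non-zero
  polynomials may have value \<open>\<infinity>\<close>, non-zero constants may not. With the pointwise order on
  functions, \<open>\<mu> < \<nu>\<close> means \<open>\<mu> \<le> \<nu>\<close> and \<open>\<mu> \<noteq> \<nu>\<close>.\<close>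

definition is_valuation :: "('k::field poly \<Rightarrow> 'v::linordered_ab_group_add extended) \<Rightarrow> bool" where
  "is_valuation \<nu> \<longleftrightarrow>
     (\<forall>f. \<nu> f \<noteq> Minf) \<and>
     (\<forall>f g. \<nu> (f * g) = \<nu> f + \<nu> g) \<and>
     (\<forall>f g. \<nu> (f + g) \<ge> min (\<nu> f) (\<nu> g)) \<and>
     (\<forall>c. \<nu> [:c:] = Pinf \<longleftrightarrow> c = 0)"

primrec fin_part :: "'v extended \<Rightarrow> 'v" where
  "fin_part (Fin a) = a"

definition value_group :: "('k::field poly \<Rightarrow> 'v::linordered_ab_group_add extended) \<Rightarrow> 'v set" where
  "value_group \<nu> = group_closure {a. \<exists>f. \<nu> f = Fin a}"


section \<open>The graded algebra and key polynomials\<close>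

definition val_ge :: "('k::field poly \<Rightarrow> 'v::linordered_ab_group_add extended) \<Rightarrow> 'v \<Rightarrow> 'k poly set" where
  "val_ge \<nu> \<alpha> = {g. \<nu> g \<ge> Fin \<alpha>}"

definition val_gt :: "('k::field poly \<Rightarrow> 'v::linordered_ab_group_add extended) \<Rightarrow> 'v \<Rightarrow> 'k poly set" where
  "val_gt \<nu> \<alpha> = {g. \<nu> g > Fin \<alpha>}"

text \<open>The graded algebra \<open>\<Oplus> P\<^sub>\<alpha> / P\<^sub>\<alpha>\<^sup>+\<close> is built as the quotient of the ring \<open>\<Oplus> P\<^sub>\<alpha>\<close> by its
  homogeneous ideal \<open>\<Oplus> P\<^sub>\<alpha>\<^sup>+\<close>, where \<open>\<alpha>\<close> runs through the value group. The ring \<open>\<Oplus> P\<^sub>\<alpha>\<close> is a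
  subring of the group algebra \<open>K[x][\<Lambda>]\<close>, which is the type \<open>'v \<Rightarrow>\<^sub>0 'k poly\<close> with its convolution
  product.\<close>

definition filtration_ring ::
    "('k::field poly \<Rightarrow> 'v::linordered_ab_group_add extended) \<Rightarrow> ('v \<Rightarrow>\<^sub>0 'k poly) ring" where
  "filtration_ring \<nu> =
     \<lparr>carrier = {F. Poly_Mapping.keys F \<subseteq> value_group \<nu> \<and> (\<forall>\<alpha>. Poly_Mapping.lookup F \<alpha> \<in> val_ge \<nu> \<alpha>)},
      mult = (*), one = 1, zero = 0, add = (+)\<rparr>"

definition filtration_ideal ::
    "('k::field poly \<Rightarrow> 'v::linordered_ab_group_add extended) \<Rightarrow> ('v \<Rightarrow>\<^sub>0 'k poly) set" where
  "filtration_ideal \<nu> =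
     {F. Poly_Mapping.keys F \<subseteq> value_group \<nu> \<and> (\<forall>\<alpha>. Poly_Mapping.lookup F \<alpha> \<in> val_gt \<nu> \<alpha>)}"

definition graded_algebra ::
    "('k::field poly \<Rightarrow> 'v::linordered_ab_group_add extended) \<Rightarrow> ('v \<Rightarrow>\<^sub>0 'k poly) set ring" where
  "graded_algebra \<nu> = filtration_ring \<nu> Quot filtration_ideal \<nu>"

lemma is_valuation_0:
  assumes "is_valuation \<nu>"
  shows "\<nu> 0 = Pinf"
  using assms unfolding is_valuation_def by (metis pCons_0_0)

lemma is_valuation_const_finite:
  assumes "is_valuation \<nu>" "c \<noteq> 0"
  obtains a where "\<nu> [:c:] = Fin a"
  using assms unfolding is_valuation_def by (metis extended.exhaust)

lemma is_valuation_1: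
  assumes "is_valuation \<nu>"
  shows "\<nu> 1 = Fin 0"
proof -
  obtain a where a: "\<nu> [:1:] = Fin a"
    using is_valuation_const_finite[OF assms, of 1] by auto
  have "\<nu> ([:1:] * [:1:]) = \<nu> [:1:] + \<nu> [:1:]"
    using assms unfolding is_valuation_def by blast
  with a show ?thesis by (simp add: one_pCons)
qed

lemma is_valuation_minus:
  assumes "is_valuation \<nu>"
  shows "\<nu> (- f) = \<nu> f"
proof -
  obtain a where a: "\<nu> [:-1:] = Fin a"
    using is_valuation_const_finite[OF assms, of "-1"] by auto
  have mult: "\<nu> (f * g) = \<nu> f + \<nu> g" for f g
    using assms unfolding is_valuation_def by blast
  have "\<nu> ([:-1:] * [:-1:]) = Fin (a + a)"
    unfolding mult a by simp
  then have "Fin (a + a) = \<nu> 1" by (simp add: one_pCons)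
  then have "a = 0" using is_valuation_1[OF assms] by simp
  have "\<nu> ([:-1:] * f) = Fin 0 + \<nu> f"
    unfolding mult a \<open>a = 0\<close> ..
  then show ?thesis by (cases "\<nu> f") simp_all
qed

lemma val_ge_mult:
  "is_valuation \<nu> \<Longrightarrow> f \<in> val_ge \<nu> \<alpha> \<Longrightarrow> g \<in> val_ge \<nu> \<beta> \<Longrightarrow> f * g \<in> val_ge \<nu> (\<alpha> + \<beta>)"
  unfolding is_valuation_def val_ge_def
  by (cases "\<nu> f"; cases "\<nu> g") (auto simp: add_mono)

lemma val_gt_mult:
  "is_valuation \<nu> \<Longrightarrow> f \<in> val_ge \<nu> \<alpha> \<Longrightarrow> g \<in> val_gt \<nu> \<beta> \<Longrightarrow> f * g \<in> val_gt \<nu> (\<alpha> + \<beta>)"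
  unfolding is_valuation_def val_ge_def val_gt_def
  by (cases "\<nu> f"; cases "\<nu> g") (auto simp: add_le_less_mono)

lemma val_ge_add:
  "is_valuation \<nu> \<Longrightarrow> f \<in> val_ge \<nu> \<alpha> \<Longrightarrow> g \<in> val_ge \<nu> \<alpha> \<Longrightarrow> f + g \<in> val_ge \<nu> \<alpha>"
  unfolding is_valuation_def val_ge_def by (metis mem_Collect_eq min.boundedI order_trans)

lemma val_gt_add:
  "is_valuation \<nu> \<Longrightarrow> f \<in> val_gt \<nu> \<alpha> \<Longrightarrow> g \<in> val_gt \<nu> \<alpha> \<Longrightarrow> f + g \<in> val_gt \<nu> \<alpha>"
  unfolding is_valuation_def val_gt_def by (metis mem_Collect_eq min_less_iff_conj less_le_trans)

lemma val_ge_0: "is_valuation \<nu> \<Longrightarrow> 0 \<in> val_ge \<nu> \<alpha>"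
  by (simp add: val_ge_def is_valuation_0)

lemma val_gt_0: "is_valuation \<nu> \<Longrightarrow> 0 \<in> val_gt \<nu> \<alpha>"
  by (simp add: val_gt_def is_valuation_0)

lemma filtration_mult_aux:
  fixes A B C :: "'v::linordered_ab_group_add \<Rightarrow> 'k::field poly set" and F G :: "'v \<Rightarrow>\<^sub>0 'k poly"
  assumes "\<And>\<alpha>. Poly_Mapping.lookup F \<alpha> \<in> A \<alpha>" "\<And>\<alpha>. Poly_Mapping.lookup G \<alpha> \<in> B \<alpha>"
    and mult: "\<And>\<alpha> \<beta> f g. f \<in> A \<alpha> \<Longrightarrow> g \<in> B \<beta> \<Longrightarrow> f * g \<in> C (\<alpha> + \<beta>)"
    and add: "\<And>\<alpha> f g. f \<in> C \<alpha> \<Longrightarrow> g \<in> C \<alpha> \<Longrightarrow> f + g \<in> C \<alpha>"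
    and zero: "\<And>\<alpha>. 0 \<in> C \<alpha>"
  shows "Poly_Mapping.lookup (F * G) \<gamma> \<in> C \<gamma>"
proof -
  have Sum: "Sum_any h \<in> C \<gamma>" if "\<And>x. h x \<in> C \<gamma>" for h :: "'v \<Rightarrow> 'k poly"
  proof (cases "finite {a. h a \<noteq> 0}")
    case True
    have "sum h S \<in> C \<gamma>" if "finite S" for S
      using that by (induction S rule: finite_induct) (auto simp: zero add \<open>\<And>x. h x \<in> C \<gamma>\<close>)
    with True show ?thesis by (simp add: Sum_any.expand_set)
  qed (simp add: zero)
  show ?thesis
    unfolding times_poly_mapping.rep_eq prod_fun_def
  proof (rule Sum)
    fix a
    show "Poly_Mapping.lookup F a * (\<Sum>b. Poly_Mapping.lookup G b when \<gamma> = a + b) \<in> C \<gamma>"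
    proof -
      have "(\<Sum>b. Poly_Mapping.lookup G b when \<gamma> = a + b) =
          (\<Sum>b. Poly_Mapping.lookup G b when b = \<gamma> - a)"
        by (intro Sum_any.cong) (auto simp: when_def)
      also have "\<dots> = Poly_Mapping.lookup G (\<gamma> - a)"
        by simp
      finally show ?thesis
        using mult[OF assms(1)[of a] assms(2)[of "\<gamma> - a"]] by simp
    qed
  qed
qed

lemma keys_mult_subset_value_group:
  assumes "Poly_Mapping.keys F \<subseteq> value_group \<nu>" "Poly_Mapping.keys G \<subseteq> value_group \<nu>"
  shows "Poly_Mapping.keys (F * G) \<subseteq> value_group \<nu>"
  using keys_mult[of F G] assms unfolding value_group_def by (blast intro: group_closure_add)

lemma keys_add_subset:
  assumes "Poly_Mapping.keys F \<subseteq> S" "Poly_Mapping.keys G \<subseteq> S"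
  shows "Poly_Mapping.keys (F + G) \<subseteq> S"
  using Poly_Mapping.keys_add[of F G] assms by blast

lemma cring_filtration_ring:
  fixes \<nu> :: "'k::field poly \<Rightarrow> 'v::linordered_ab_group_add extended"
  assumes v: "is_valuation \<nu>"
  shows "cring (filtration_ring \<nu>)"
proof (rule cringI)
  show "abelian_group (filtration_ring \<nu>)"
  proof (rule abelian_groupI)
    fix F G assume "F \<in> carrier (filtration_ring \<nu>)" "G \<in> carrier (filtration_ring \<nu>)"
    then show "F \<oplus>\<^bsub>filtration_ring \<nu>\<^esub> G \<in> carrier (filtration_ring \<nu>)"
      using keys_add_subset[of F "value_group \<nu>" G] val_ge_add[OF v]
      by (auto simp: filtration_ring_def lookup_add)
  next
    fix F assume F: "F \<in> carrier (filtration_ring \<nu>)"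
    have "- F \<in> carrier (filtration_ring \<nu>)"
      using F is_valuation_minus[OF v] by (simp add: filtration_ring_def val_ge_def)
    moreover have "- F \<oplus>\<^bsub>filtration_ring \<nu>\<^esub> F = \<zero>\<^bsub>filtration_ring \<nu>\<^esub>"
      by (simp add: filtration_ring_def)
    ultimately show "\<exists>G\<in>carrier (filtration_ring \<nu>).
        G \<oplus>\<^bsub>filtration_ring \<nu>\<^esub> F = \<zero>\<^bsub>filtration_ring \<nu>\<^esub>"
      by blast
  qed (auto simp: filtration_ring_def ac_simps val_ge_0[OF v])
  show "comm_monoid (filtration_ring \<nu>)"
  proof (rule comm_monoidI)
    fix F G assume "F \<in> carrier (filtration_ring \<nu>)" "G \<in> carrier (filtration_ring \<nu>)"
    then show "F \<otimes>\<^bsub>filtration_ring \<nu>\<^esub> G \<in> carrier (filtration_ring \<nu>)"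
      using keys_mult_subset_value_group[of F \<nu> G]
        filtration_mult_aux[of F "val_ge \<nu>" G "val_ge \<nu>" "val_ge \<nu>",
          OF _ _ val_ge_mult[OF v] val_ge_add[OF v] val_ge_0[OF v]]
      by (auto simp: filtration_ring_def)
  next
    have "1 \<in> val_ge \<nu> 0" using is_valuation_1[OF v] by (simp add: val_ge_def)
    then show "\<one>\<^bsub>filtration_ring \<nu>\<^esub> \<in> carrier (filtration_ring \<nu>)"
      by (auto simp: filtration_ring_def lookup_one when_def val_ge_0[OF v] value_group_def)
  qed (auto simp: filtration_ring_def ac_simps)
qed (auto simp: filtration_ring_def algebra_simps)

lemma ideal_filtration_ideal:
  fixes \<nu> :: "'k::field poly \<Rightarrow> 'v::linordered_ab_group_add extended"
  assumes v: "is_valuation \<nu>"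
  shows "ideal (filtration_ideal \<nu>) (filtration_ring \<nu>)"
proof -
  interpret cring "filtration_ring \<nu>" by (rule cring_filtration_ring[OF v])
  have sub: "filtration_ideal \<nu> \<subseteq> carrier (filtration_ring \<nu>)"
    by (auto simp: filtration_ideal_def filtration_ring_def val_ge_def val_gt_def intro: less_imp_le)
  have minus: "\<ominus>\<^bsub>filtration_ring \<nu>\<^esub> F = - F" if "F \<in> carrier (filtration_ring \<nu>)" for F
  proof -
    have "- F \<in> carrier (filtration_ring \<nu>)"
      using that is_valuation_minus[OF v] by (simp add: filtration_ring_def val_ge_def)
    with that show ?thesis
      by (intro minus_equality) (simp_all add: filtration_ring_def)
  qed
  have mult: "F * G \<in> filtration_ideal \<nu>"
    if "F \<in> carrier (filtration_ring \<nu>)" "G \<in> filtration_ideal \<nu>" for F G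
    using that keys_mult_subset_value_group[of F \<nu> G]
      filtration_mult_aux[of F "val_ge \<nu>" G "val_gt \<nu>" "val_gt \<nu>",
        OF _ _ val_gt_mult[OF v] val_gt_add[OF v] val_gt_0[OF v]]
    by (auto simp: filtration_ring_def filtration_ideal_def)
  show ?thesis
  proof (rule idealI)
    show "subgroup (filtration_ideal \<nu>) (add_monoid (filtration_ring \<nu>))"
    proof (rule add.subgroupI)
      show "filtration_ideal \<nu> \<noteq> {}"
        using val_gt_0[OF v] by (auto simp: filtration_ideal_def intro: exI[of _ 0])
    next
      fix F assume F: "F \<in> filtration_ideal \<nu>"
      then have "\<ominus>\<^bsub>filtration_ring \<nu>\<^esub> F = - F"
        using minus sub by auto
      with F show "\<ominus>\<^bsub>filtration_ring \<nu>\<^esub> F \<in> filtration_ideal \<nu>"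
        using is_valuation_minus[OF v] by (simp add: filtration_ideal_def val_gt_def)
    next
      fix F G assume "F \<in> filtration_ideal \<nu>" "G \<in> filtration_ideal \<nu>"
      then show "F \<oplus>\<^bsub>filtration_ring \<nu>\<^esub> G \<in> filtration_ideal \<nu>"
        using keys_add_subset[of F "value_group \<nu>" G] val_gt_add[OF v]
        by (auto simp: filtration_ideal_def filtration_ring_def lookup_add)
    qed (use sub in auto)
  next
    fix G F assume "G \<in> filtration_ideal \<nu>" "F \<in> carrier (filtration_ring \<nu>)"
    then show "F \<otimes>\<^bsub>filtration_ring \<nu>\<^esub> G \<in> filtration_ideal \<nu>"
      and "G \<otimes>\<^bsub>filtration_ring \<nu>\<^esub> F \<in> filtration_ideal \<nu>"
      using mult[of F G] by (simp_all add: filtration_ring_def mult.commute)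
  qed (rule ring_axioms)
qed

lemma cring_graded_algebra:
  "is_valuation \<nu> \<Longrightarrow> cring (graded_algebra \<nu>)"
  unfolding graded_algebra_def
  by (intro ideal.quotient_is_cring ideal_filtration_ideal cring_filtration_ring)

text \<open>The class of \<open>g\<close> placed in degree \<open>\<nu> g\<close>.\<close>

definition initial_form ::
    "('k::field poly \<Rightarrow> 'v::linordered_ab_group_add extended) \<Rightarrow> 'k poly \<Rightarrow> ('v \<Rightarrow>\<^sub>0 'k poly) set" where
  "initial_form \<nu> g =
     (case \<nu> g of
        Fin \<alpha> \<Rightarrow> filtration_ideal \<nu> +>\<^bsub>filtration_ring \<nu>\<^esub> Poly_Mapping.single \<alpha> g
      | _ \<Rightarrow> \<zero>\<^bsub>graded_algebra \<nu>\<^esub>)"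

definition val_dvd ::
    "('k::field poly \<Rightarrow> 'v::linordered_ab_group_add extended) \<Rightarrow> 'k poly \<Rightarrow> 'k poly \<Rightarrow> bool" where
  "val_dvd \<nu> h g \<longleftrightarrow> initial_form \<nu> h divides\<^bsub>graded_algebra \<nu>\<^esub> initial_form \<nu> g"

definition KP :: "('k::field poly \<Rightarrow> 'v::linordered_ab_group_add extended) \<Rightarrow> 'k poly set" where
  "KP \<nu> = {g. lead_coeff g = 1 \<and>
     primeideal (PIdl\<^bsub>graded_algebra \<nu>\<^esub> (initial_form \<nu> g)) (graded_algebra \<nu>) \<and>
     PIdl\<^bsub>graded_algebra \<nu>\<^esub> (initial_form \<nu> g) \<noteq> {\<zero>\<^bsub>graded_algebra \<nu>\<^esub>} \<and>
     (\<forall>f. f \<noteq> 0 \<and> degree f < degree g \<longrightarrow> \<not> val_dvd \<nu> g f)}"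


section \<open>Augmentations\<close>

definition exp_coeff :: "'k::field poly \<Rightarrow> 'k poly \<Rightarrow> nat \<Rightarrow> 'k poly" where
  "exp_coeff \<chi> f s = (f div \<chi> ^ s) mod \<chi>"

text \<open>Only the indices \<open>s \<le> degree f\<close> can contribute to the \<open>\<chi>\<close>-expansion of \<open>f\<close>.\<close>

lemma exp_coeff_degree:
  "degree \<chi> > 0 \<Longrightarrow> degree (exp_coeff \<chi> f s) < degree \<chi>"
  unfolding exp_coeff_def
  by (cases "(f div \<chi> ^ s) mod \<chi> = 0") (auto intro: degree_mod_less')

lemma exp_coeff_eq_0:
  assumes "degree \<chi> > 0" "degree f < s"
  shows "exp_coeff \<chi> f s = 0"
proof -
  from assms have "\<chi> \<noteq> 0" by auto
  then have "degree (\<chi> ^ s) = s * degree \<chi>" by (simp add: degree_power_eq)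
  moreover have "s \<le> s * degree \<chi>" using assms by simp
  ultimately have "degree f < degree (\<chi> ^ s)" using assms by linarith
  then show ?thesis by (simp add: exp_coeff_def div_poly_less)
qed

lemma exp_coeff_expansion:
  assumes "degree \<chi> > 0"
  shows "f = (\<Sum>s\<le>degree f. exp_coeff \<chi> f s * \<chi> ^ s)"
proof -
  have expand: "f = (\<Sum>s<n. exp_coeff \<chi> f s * \<chi> ^ s) + (f div \<chi> ^ n) * \<chi> ^ n" for n
  proof (induction n)
    case (Suc n)
    have "f div \<chi> ^ n = (f div \<chi> ^ n) div \<chi> * \<chi> + exp_coeff \<chi> f n"
      by (simp add: exp_coeff_def)
    also have "(f div \<chi> ^ n) div \<chi> = f div \<chi> ^ Suc n"
      by (metis poly_div_mult_right power_Suc2)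
    finally have "(f div \<chi> ^ n) * \<chi> ^ n =
        exp_coeff \<chi> f n * \<chi> ^ n + (f div \<chi> ^ Suc n) * \<chi> ^ Suc n"
      by (metis (no_types, lifting) add.commute distrib_right mult.assoc power_Suc)
    with Suc show ?case by (simp add: add.assoc)
  qed simp
  show ?thesis
  proof -
    from assms have "\<chi> \<noteq> 0" by auto
    then have "degree (\<chi> ^ Suc (degree f)) = Suc (degree f) * degree \<chi>"
      by (rule degree_power_eq)
    moreover have "Suc (degree f) * 1 \<le> Suc (degree f) * degree \<chi>"
      using assms by (intro mult_le_mono2) simp
    ultimately have "f div \<chi> ^ Suc (degree f) = 0"
      by (intro div_poly_less) (simp only: mult_1_right Suc_le_eq)
    with expand[of "Suc (degree f)"] show ?thesis
      by (metis add.right_neutral lessThan_Suc_atMost mult_zero_left)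
  qed
qed

definition augmentation ::
    "('k::field poly \<Rightarrow> 'v::linordered_ab_group_add extended) \<Rightarrow> 'k poly \<Rightarrow> 'v
     \<Rightarrow> 'k poly \<Rightarrow> 'v extended" where
  "augmentation \<rho> \<chi> \<beta> f =
     Min ((\<lambda>s. \<rho> (exp_coeff \<chi> f s) + Fin (nmult s \<beta>)) ` {..degree f})"


section \<open>Continuous MacLane chains\<close>

text \<open>The values \<open>\<chi> 0\<close> and \<open>\<beta> 0\<close> play no role.\<close>

definition continuous_chain ::
    "(nat \<Rightarrow> 'k::field poly \<Rightarrow> 'v::linordered_ab_group_add extended) \<Rightarrow> (nat \<Rightarrow> 'k poly) \<Rightarrow>
     (nat \<Rightarrow> 'v) \<Rightarrow> nat \<Rightarrow> bool" where
  "continuous_chain \<rho> \<chi> \<beta> m \<longleftrightarrow>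
     (\<forall>i. is_valuation (\<rho> i)) \<and> KP (\<rho> 0) \<noteq> {} \<and>
     (\<forall>i\<ge>1. \<chi> i \<in> KP (\<rho> (i - 1)) \<and>
             Fin (\<beta> i) > \<rho> (i - 1) (\<chi> i) \<and>
             \<rho> i = augmentation (\<rho> (i - 1)) (\<chi> i) (\<beta> i) \<and>
             degree (\<chi> i) = m \<and>
             \<not> val_dvd (\<rho> i) (\<chi> (i + 1)) (\<chi> i))"

text \<open>All \<open>\<rho> i\<close> with \<open>i \<ge> 1\<close> have the same value group.\<close>

definition stable_value_group ::
    "(nat \<Rightarrow> 'k::field poly \<Rightarrow> 'v::linordered_ab_group_add extended) \<Rightarrow> 'v set" where
  "stable_value_group \<rho> = value_group (\<rho> 1)"

definition stable ::
    "(nat \<Rightarrow> 'k::field poly \<Rightarrow> 'v::linordered_ab_group_add extended) \<Rightarrow> 'k poly \<Rightarrow> bool" where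
  "stable \<rho> f \<longleftrightarrow> (\<exists>c. \<forall>\<^sub>F i in sequentially. \<rho> i f = c)"

definition m_infty ::
    "(nat \<Rightarrow> 'k::field poly \<Rightarrow> 'v::linordered_ab_group_add extended) \<Rightarrow> enat" where
  "m_infty \<rho> = (INF f\<in>{f. \<not> stable \<rho> f}. enat (degree f))"

definition essential_chain ::
    "(nat \<Rightarrow> 'k::field poly \<Rightarrow> 'v::linordered_ab_group_add extended) \<Rightarrow> (nat \<Rightarrow> 'k poly) \<Rightarrow>
     (nat \<Rightarrow> 'v) \<Rightarrow> nat \<Rightarrow> bool" where
  "essential_chain \<rho> \<chi> \<beta> m \<longleftrightarrow>
     continuous_chain \<rho> \<chi> \<beta> m \<and> enat m < m_infty \<rho> \<and> m_infty \<rho> < (\<infinity>::enat)"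

definition KP_infty ::
    "(nat \<Rightarrow> 'k::field poly \<Rightarrow> 'v::linordered_ab_group_add extended) \<Rightarrow> 'k poly set" where
  "KP_infty \<rho> = {\<phi>. lead_coeff \<phi> = 1 \<and> \<not> stable \<rho> \<phi> \<and> enat (degree \<phi>) = m_infty \<rho>}"


section \<open>The invariants \<open>t\<^sub>\<infinity>\<close> and \<open>b\<^sub>\<infinity>\<close>\<close>

definition t_char ::
    "(nat \<Rightarrow> 'k::field poly \<Rightarrow> 'v::linordered_ab_group_add extended) \<Rightarrow> (nat \<Rightarrow> 'k poly) \<Rightarrow>
     'k poly \<Rightarrow> nat \<Rightarrow> nat" where
  "t_char \<rho> \<chi> \<phi> i = Max {s. \<rho> i (exp_coeff (\<chi> i) \<phi> s * \<chi> i ^ s) = \<rho> i \<phi>}"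

definition t_infty ::
    "(nat \<Rightarrow> 'k::field poly \<Rightarrow> 'v::linordered_ab_group_add extended) \<Rightarrow> (nat \<Rightarrow> 'k poly) \<Rightarrow> nat" where
  "t_infty \<rho> \<chi> =
     (THE t. \<forall>\<phi>\<in>KP_infty \<rho>. \<forall>\<^sub>F i in sequentially. t_char \<rho> \<chi> \<phi> i = t)"

text \<open>\<open>f(x + y)\<close> is an element of \<open>K[x][y]\<close>, where \<open>y\<close> is the variable of the outer polynomials and
  \<open>x = [:[:0, 1:]:]\<close>; hence \<open>x + y = [:[:0, 1:], 1:]\<close>.\<close>

definition hasse :: "nat \<Rightarrow> 'k::field poly \<Rightarrow> 'k poly" where
  "hasse b f = coeff (pcompose (map_poly (\<lambda>c. [:c:]) f) [:[:0, 1:], 1:]) b"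

definition eps_quot ::
    "('k::field poly \<Rightarrow> 'v::linordered_ab_group_add extended) \<Rightarrow> 'k poly \<Rightarrow> nat \<Rightarrow> 'v rat_hull" where
  "eps_quot \<nu> f b = hull_frac (fin_part (\<nu> f) - fin_part (\<nu> (hasse b f))) b"

text \<open>If \<open>\<nu> (hasse b f) = \<infinity>\<close> the quotient is \<open>-\<infinity>\<close>, so such \<open>b\<close> do not compete for the maximum.
  The remaining \<open>b \<ge> 1\<close> are finite in number, and include \<open>degree f\<close> if \<open>f\<close> is not constant.\<close>

definition eps_indices ::
    "('k::field poly \<Rightarrow> 'v::linordered_ab_group_add extended) \<Rightarrow> 'k poly \<Rightarrow> nat set" where
  "eps_indices \<nu> f = {b. b \<ge> 1 \<and> \<nu> (hasse b f) \<noteq> Pinf}"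

definition eps ::
    "('k::field poly \<Rightarrow> 'v::linordered_ab_group_add extended) \<Rightarrow> 'k poly \<Rightarrow> 'v rat_hull" where
  "eps \<nu> f = Max (eps_quot \<nu> f ` eps_indices \<nu> f)"

definition I_set ::
    "('k::field poly \<Rightarrow> 'v::linordered_ab_group_add extended) \<Rightarrow> 'k poly \<Rightarrow> nat set" where
  "I_set \<nu> f = {b \<in> eps_indices \<nu> f. eps_quot \<nu> f b = eps \<nu> f}"

definition b_infty ::
    "(nat \<Rightarrow> 'k::field poly \<Rightarrow> 'v::linordered_ab_group_add extended) \<Rightarrow> (nat \<Rightarrow> 'k poly) \<Rightarrow> nat" where
  "b_infty \<rho> \<chi> =
     (THE b. b > 0 \<and> (\<forall>\<nu>. is_valuation \<nu> \<and> (\<forall>i. \<nu> > \<rho> i) \<longrightarrow>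
        (\<forall>\<^sub>F j in sequentially. I_set \<nu> (\<chi> j) = {b})))"

end

theory Submission
  imports Defs
begin

text \<open>All the valuations of the chain agree on polynomials of degree less than \<open>m\<close>, and
  there \<open>\<chi> (i + 1) - \<chi> i\<close> has value exactly \<open>\<beta> i\<close> (\<open>value_key_step\<close>). Thus the \<open>\<beta> i\<close> lie in
  the stable value group and increase, and the hypothesis says that they eventually exceed
  each given element of this group. Both invariants compare the \<open>\<beta> i\<close> with values of other
  polynomials, and the proof shows that these other values are bounded on the relevant side.

  The source of the bounds is an elementary remark: a monic polynomial of degree \<open>k * m\<close> has
  value at most \<open>k * \<beta> 1\<close> under \<open>\<rho> 1\<close>, since \<open>1\<close> is the top coefficient of its \<open>\<chi>
  1\<close>-expansion (\<open>monic_value_le\<close>). Taking \<open>m\<close>-th powers, one bounds the value of any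
  polynomial by that of its leading coefficient plus a constant depending on the degree.
  There are two consequences. Hasse derivatives lower values by a bounded amount in each
  degree (\<open>hasse_value_ge\<close>). And in characteristic \<open>0\<close> the derivatives of the \<open>\<chi> i\<close>, which
  all have leading coefficient \<open>m\<close>, have values bounded above (\<open>pderiv_key_bounded\<close>).

  For \<open>b_infty\<close>: a valuation above the chain gives \<open>\<chi> j\<close> the value \<open>\<beta> j\<close> and agrees with the
  chain in degree less than \<open>m\<close> (\<open>valuation_above_low_degree\<close>). So the quotients to compare
  are \<open>(\<beta> j - c) / b\<close>, where the value \<open>c\<close> of the \<open>b\<close>-th derivative is bounded below, and
  for \<open>b = 1\<close> also bounded above; for large \<open>\<beta> j\<close> the quotient with \<open>b = 1\<close> wins
  (\<open>eventually_I_set\<close>). That \<open>1\<close> is the only number with this property requires a valuation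
  above the chain; the pointwise limit of the chain is one (\<open>is_valuation_limit\<close>).

  For \<open>t_infty\<close>: let \<open>\<phi>\<close> be a limit key polynomial. In characteristic \<open>0\<close> its derivative is
  non-zero; having smaller degree, it is stable. Differentiating the \<open>\<chi> i\<close>-expansion of \<open>\<phi>\<close>,
  only the product of the linear coefficient and the derivative of \<open>\<chi> i\<close> can have bounded
  value. So the values of the linear coefficient are bounded above, and for large \<open>\<beta> i\<close> the
  linear term dominates those of higher order; the constant term cannot dominate, as \<open>\<phi>\<close> is
  not stable (\<open>eventually_t_char\<close>).\<close>


section \<open>Valuations and divisibility of initial forms\<close>

lemma valuation_not_Minf: "is_valuation \<nu> \<Longrightarrow> \<nu> f \<noteq> Minf"
  by (simp add: is_valuation_def)

lemma valuation_mult: "is_valuation \<nu> \<Longrightarrow> \<nu> (f * g) = \<nu> f + \<nu> g"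
  by (simp add: is_valuation_def)

lemma valuation_add_ge:
  "is_valuation \<nu> \<Longrightarrow> c \<le> \<nu> f \<Longrightarrow> c \<le> \<nu> g \<Longrightarrow> c \<le> \<nu> (f + g)"
  unfolding is_valuation_def by (meson min.boundedI order_trans)

lemma valuation_diff_ge:
  "is_valuation \<nu> \<Longrightarrow> c \<le> \<nu> f \<Longrightarrow> c \<le> \<nu> g \<Longrightarrow> c \<le> \<nu> (f - g)"
  using valuation_add_ge[of \<nu> c f "- g"] is_valuation_minus[of \<nu> g] by simp

lemma valuation_diff_gt:
  assumes v: "is_valuation \<nu>" and "c < \<nu> f" "c < \<nu> g"
  shows "c < \<nu> (f - g)"
proof -
  have "c < min (\<nu> f) (\<nu> g)" using assms by simp
  also have "\<dots> \<le> \<nu> (f - g)" by (rule valuation_diff_ge[OF v]) simp_all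
  finally show ?thesis .
qed

lemma valuation_sum_ge:
  "is_valuation \<nu> \<Longrightarrow> (\<And>x. x \<in> S \<Longrightarrow> c \<le> \<nu> (f x)) \<Longrightarrow> c \<le> \<nu> (\<Sum>x\<in>S. f x)"
proof (induction S rule: infinite_finite_induct)
  case (insert x S)
  then show ?case by (simp add: valuation_add_ge)
qed (simp_all add: is_valuation_0)

lemma valuation_add_eq:
  assumes v: "is_valuation \<nu>" and less: "\<nu> f < \<nu> g"
  shows "\<nu> (f + g) = \<nu> f"
proof (rule antisym)
  show "\<nu> f \<le> \<nu> (f + g)"
    using less by (intro valuation_add_ge[OF v]) auto
  show "\<nu> (f + g) \<le> \<nu> f"
  proof (rule ccontr)
    assume "\<not> \<nu> (f + g) \<le> \<nu> f"
    then have "\<nu> f < \<nu> (f + g - g)"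
      using less by (intro valuation_diff_gt[OF v]) auto
    then show False by simp
  qed
qed

lemma valuation_power:
  "is_valuation \<nu> \<Longrightarrow> \<nu> f = Fin a \<Longrightarrow> \<nu> (f ^ n) = Fin (nmult n a)"
  by (induction n) (simp_all add: is_valuation_1 valuation_mult add.commute)

lemma valuation_of_nat_ge: "is_valuation \<nu> \<Longrightarrow> Fin 0 \<le> \<nu> (of_nat n)"
  by (induction n) (simp_all add: is_valuation_0 is_valuation_1 valuation_add_ge)

lemma Fin_mult_ge:
  assumes "is_valuation \<nu>" "Fin a \<le> \<nu> f" "Fin b \<le> \<nu> g"
  shows "Fin (a + b) \<le> \<nu> (f * g)"
  using val_ge_mult[of \<nu> f a g b] assms by (simp add: val_ge_def)

lemma le_valuation_cancel:
  assumes "is_valuation \<nu>" "\<nu> g \<le> Fin b" "Fin a \<le> \<nu> (f * g)"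
  shows "Fin (a - b) \<le> \<nu> f"
  using assms valuation_not_Minf[OF assms(1), of f] valuation_not_Minf[OF assms(1), of g]
  by (cases "\<nu> f"; cases "\<nu> g")
    (auto simp: valuation_mult diff_le_eq intro: order_trans add_left_mono)

lemma value_in_value_group: "\<nu> f = Fin a \<Longrightarrow> a \<in> value_group \<nu>"
  unfolding value_group_def by (auto intro: group_closure.base)

text \<open>The graded algebra enters the proof only through this criterion: if \<open>g\<close> and \<open>h * q\<close>
  agree up to terms of higher value, then \<open>h * q\<close> has the value of \<open>g\<close>, and the initial form
  of \<open>g\<close> is the product of those of \<open>h\<close> and \<open>q\<close>. Non-divisibility by a key polynomial
  thereby becomes a statement about values.\<close>

lemma val_dvd_if_close:
  fixes \<nu> :: "'k::field poly \<Rightarrow> 'v::linordered_ab_group_add extended"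
  assumes v: "is_valuation \<nu>" and close: "\<nu> g = Pinf \<or> \<nu> g < \<nu> (g - h * q)"
  shows "val_dvd \<nu> h g"
proof -
  let ?R = "filtration_ring \<nu>" and ?I = "filtration_ideal \<nu>"
  interpret R: cring ?R by (rule cring_filtration_ring[OF v])
  interpret I: ideal ?I ?R by (rule ideal_filtration_ideal[OF v])
  interpret G: cring "graded_algebra \<nu>" by (rule cring_graded_algebra[OF v])
  have single: "Poly_Mapping.single \<alpha> f \<in> carrier ?R" if "\<nu> f = Fin \<alpha>" for f \<alpha>
    using that value_in_value_group[of \<nu> f \<alpha>]
    by (auto simp: filtration_ring_def val_ge_def lookup_single when_def is_valuation_0[OF v])
  have coset: "?I +>\<^bsub>?R\<^esub> F \<in> carrier (graded_algebra \<nu>)" if "F \<in> carrier ?R" for F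
    using that by (auto simp: graded_algebra_def FactRing_def A_RCOSETS_def')
  have form: "initial_form \<nu> f \<in> carrier (graded_algebra \<nu>)" for f
    by (auto simp: initial_form_def coset single split: extended.splits)
  show ?thesis
  proof (cases "\<nu> g = Pinf")
    case True
    then have "initial_form \<nu> g = \<zero>\<^bsub>graded_algebra \<nu>\<^esub>" by (simp add: initial_form_def)
    moreover have "initial_form \<nu> h \<otimes>\<^bsub>graded_algebra \<nu>\<^esub> \<zero>\<^bsub>graded_algebra \<nu>\<^esub> = \<zero>\<^bsub>graded_algebra \<nu>\<^esub>"
      using form by simp
    ultimately show ?thesis
      unfolding val_dvd_def factor_def using G.zero_closed by metis
  next
    case False
    then obtain \<alpha> where \<alpha>: "\<nu> g = Fin \<alpha>"
      using valuation_not_Minf[OF v] by (metis extended.exhaust)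
    have less: "\<nu> g < \<nu> (g - h * q)" using False close by simp
    have "\<nu> (g + - (g - h * q)) = \<nu> g"
      by (rule valuation_add_eq[OF v]) (simp only: is_valuation_minus[OF v] less)
    then have "\<nu> h + \<nu> q = Fin \<alpha>"
      by (simp add: valuation_mult[OF v] \<alpha>)
    then obtain \<eta> \<theta> where \<eta>: "\<nu> h = Fin \<eta>" and \<theta>: "\<nu> q = Fin \<theta>" and sum: "\<eta> + \<theta> = \<alpha>"
      by (cases "\<nu> h"; cases "\<nu> q") auto
    let ?h = "Poly_Mapping.single \<eta> h" and ?q = "Poly_Mapping.single \<theta> q"
      and ?g = "Poly_Mapping.single \<alpha> g"
    have hq: "?h \<otimes>\<^bsub>?R\<^esub> ?q = Poly_Mapping.single \<alpha> (h * q)"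
      by (simp add: filtration_ring_def mult_single sum)
    have hq_in: "Poly_Mapping.single \<alpha> (h * q) \<in> carrier ?R"
      by (rule single) (simp add: valuation_mult[OF v] \<eta> \<theta> sum)
    have diff_in: "Poly_Mapping.single \<alpha> (g - h * q) \<in> ?I"
      using less \<alpha> value_in_value_group[of \<nu> g \<alpha>]
      by (auto simp: filtration_ideal_def val_gt_def lookup_single when_def is_valuation_0[OF v])
    have "?g \<in> ?I +>\<^bsub>?R\<^esub> Poly_Mapping.single \<alpha> (h * q)"
      using diff_in by (auto simp: a_r_coset_def' filtration_ring_def simp flip: single_add
          intro!: bexI[of _ "Poly_Mapping.single \<alpha> (g - h * q)"])
    then have "?I +>\<^bsub>?R\<^esub> ?g = ?I +>\<^bsub>?R\<^esub> Poly_Mapping.single \<alpha> (h * q)"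
      using I.a_repr_independence'[of ?g "Poly_Mapping.single \<alpha> (h * q)"] hq_in by simp
    also have "\<dots> = initial_form \<nu> h \<otimes>\<^bsub>graded_algebra \<nu>\<^esub> (?I +>\<^bsub>?R\<^esub> ?q)"
      using I.rcoset_mult_add[OF single[OF \<eta>] single[OF \<theta>]]
      by (simp add: graded_algebra_def FactRing_def initial_form_def \<eta> hq)
    finally show ?thesis
      unfolding val_dvd_def factor_def
      using coset[OF single[OF \<theta>]] by (auto simp: initial_form_def \<alpha>)
  qed
qed


section \<open>Augmentations\<close>

lemma augmentation_le:
  assumes v: "is_valuation \<rho>" and deg: "degree \<chi> > 0"
  shows "augmentation \<rho> \<chi> \<beta> f \<le> \<rho> (exp_coeff \<chi> f s) + Fin (nmult s \<beta>)"
proof (cases "s \<le> degree f")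
  case True
  then show ?thesis unfolding augmentation_def by (intro Min_le) auto
next
  case False
  then have "exp_coeff \<chi> f s = 0" using deg by (intro exp_coeff_eq_0) auto
  then show ?thesis by (simp add: is_valuation_0[OF v])
qed

lemma augmentation_ge:
  assumes "\<And>s. c \<le> \<rho> (exp_coeff \<chi> f s) + Fin (nmult s \<beta>)"
  shows "c \<le> augmentation \<rho> \<chi> \<beta> f"
  unfolding augmentation_def using assms by (intro Min.boundedI) auto

lemma exp_coeff_0: "exp_coeff \<chi> f 0 = f mod \<chi>"
  by (simp add: exp_coeff_def)

lemma exp_coeff_Suc: "exp_coeff \<chi> f (Suc s) = exp_coeff \<chi> (f div \<chi>) s"
  by (simp add: exp_coeff_def poly_div_mult_right)

lemma exp_coeff_of_0 [simp]: "exp_coeff \<chi> 0 s = 0"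
  by (simp add: exp_coeff_def)

lemma exp_coeff_low_degree:
  assumes "degree f < degree \<chi>"
  shows "exp_coeff \<chi> f s = (if s = 0 then f else 0)"
proof (cases s)
  case (Suc k)
  have "f div \<chi> = 0" using assms by (simp add: div_poly_less)
  with Suc show ?thesis by (simp add: exp_coeff_Suc)
qed (use assms in \<open>simp add: exp_coeff_0 mod_poly_less\<close>)

text \<open>For \<open>\<chi>\<close> and \<open>f\<close> monic with \<open>degree f = k * degree \<chi>\<close> the difference \<open>f - \<chi> ^ k\<close> has
  smaller degree than \<open>\<chi> ^ k\<close>, so the quotient of \<open>f\<close> by \<open>\<chi> ^ k\<close> is \<open>1\<close>.\<close>

lemma exp_coeff_monic_top:
  fixes f \<chi> :: "'k::field poly"
  assumes "lead_coeff f = 1" "lead_coeff \<chi> = 1" "degree \<chi> > 0" "degree f = k * degree \<chi>"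
  shows "exp_coeff \<chi> f k = 1"
proof -
  have "\<chi> \<noteq> 0" using assms by auto
  then have deg: "degree (\<chi> ^ k) = degree f"
    using assms by (simp add: degree_power_eq)
  let ?g = "f - \<chi> ^ k"
  have "degree ?g \<le> degree f"
    by (intro degree_diff_le) (simp_all add: deg)
  moreover have "coeff ?g (degree f) = 0"
    using assms deg lead_coeff_power[of \<chi> k] by simp
  ultimately have "?g = 0 \<or> degree ?g < degree (\<chi> ^ k)"
    using deg by (metis le_neq_implies_less leading_coeff_0_iff)
  then have "?g div \<chi> ^ k = 0"
    by (auto simp: div_poly_less)
  moreover have "f div \<chi> ^ k = (\<chi> ^ k + ?g) div \<chi> ^ k"
    by simp
  ultimately have "f div \<chi> ^ k = 1"
    using \<open>\<chi> \<noteq> 0\<close> by (simp only: div_add_self1 power_eq_0_iff simp_thms) simp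
  then show ?thesis using assms(3) by (simp add: exp_coeff_def mod_poly_less)
qed

lemma augmentation_low_degree:
  assumes v: "is_valuation \<rho>" and deg: "degree a < degree \<chi>"
  shows "augmentation \<rho> \<chi> \<beta> a = \<rho> a"
proof (rule antisym)
  show "augmentation \<rho> \<chi> \<beta> a \<le> \<rho> a"
    using augmentation_le[OF v, of \<chi> \<beta> a 0] deg
    by (cases "\<rho> a") (simp_all add: exp_coeff_low_degree)
  show "\<rho> a \<le> augmentation \<rho> \<chi> \<beta> a"
    by (rule augmentation_ge)
      (cases "\<rho> a"; simp add: exp_coeff_low_degree deg is_valuation_0[OF v])
qed

lemma augmentation_at_key:
  assumes v: "is_valuation \<rho>" and deg: "degree \<chi> > 0"
  shows "augmentation \<rho> \<chi> \<beta> \<chi> = Fin \<beta>"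
proof -
  have "\<chi> \<noteq> 0" using deg by auto
  then have one: "exp_coeff \<chi> \<chi> (Suc s) = (if s = 0 then 1 else 0)" for s
    using deg by (simp add: exp_coeff_Suc exp_coeff_low_degree)
  show ?thesis
  proof (rule antisym)
    show "augmentation \<rho> \<chi> \<beta> \<chi> \<le> Fin \<beta>"
      using augmentation_le[OF v deg, of \<beta> \<chi> "Suc 0"] by (simp add: one is_valuation_1[OF v])
    show "Fin \<beta> \<le> augmentation \<rho> \<chi> \<beta> \<chi>"
    proof (rule augmentation_ge)
      fix s show "Fin \<beta> \<le> \<rho> (exp_coeff \<chi> \<chi> s) + Fin (nmult s \<beta>)"
        by (cases s) (auto simp: exp_coeff_0 one is_valuation_0[OF v] is_valuation_1[OF v])
    qed
  qed
qed

text \<open>If the remainder \<open>f mod \<chi>\<close> had a smaller value than \<open>f\<close>, it would be congruent to a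
  multiple of \<open>\<chi>\<close> up to higher value, so \<open>\<chi>\<close> would divide in the graded algebra a non-zero
  polynomial of smaller degree.\<close>

lemma KP_remainder_ge:
  assumes v: "is_valuation \<rho>" and key: "\<chi> \<in> KP \<rho>" and deg: "degree \<chi> > 0"
  shows "\<rho> f \<le> \<rho> (f mod \<chi>)"
proof (rule ccontr)
  assume "\<not> \<rho> f \<le> \<rho> (f mod \<chi>)"
  then have less: "\<rho> (f mod \<chi>) < \<rho> f" by simp
  have "f mod \<chi> - \<chi> * (- (f div \<chi>)) = f"
    by (simp add: add.commute)
  with less have "val_dvd \<rho> \<chi> (f mod \<chi>)"
    by (intro val_dvd_if_close[OF v, of _ _ "- (f div \<chi>)"]) simp
  moreover have "f mod \<chi> \<noteq> 0" using less by (auto simp: is_valuation_0[OF v])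
  moreover have "degree (f mod \<chi>) < degree \<chi>"
    using exp_coeff_degree[OF deg, of f 0] by (simp add: exp_coeff_0)
  ultimately show False using key by (auto simp: KP_def)
qed

lemma KP_low_degree_finite:
  assumes v: "is_valuation \<rho>" and key: "\<chi> \<in> KP \<rho>" and a: "a \<noteq> 0" "degree a < degree \<chi>"
  shows "\<rho> a \<noteq> Pinf"
  using val_dvd_if_close[OF v, of a \<chi>] key a by (auto simp: KP_def)

text \<open>Iterating the previous estimate along the \<open>\<chi>\<close>-expansion shows that no term of the
  expansion has a smaller value than \<open>f\<close>. This is why replacing the value of \<open>\<chi>\<close> by a larger
  \<open>\<beta>\<close> can only increase values.\<close>

lemma KP_expansion_ge:
  assumes v: "is_valuation \<rho>" and key: "\<chi> \<in> KP \<rho>" and deg: "degree \<chi> > 0"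
    and b: "\<rho> \<chi> \<le> Fin b"
  shows "\<rho> f \<le> \<rho> (exp_coeff \<chi> f s) + Fin (nmult s b)"
proof (induction s arbitrary: f)
  case 0
  show ?case using KP_remainder_ge[OF v key deg, of f]
    by (cases "\<rho> (f mod \<chi>)") (simp_all add: exp_coeff_0)
next
  case (Suc s)
  have "\<rho> f \<le> \<rho> (f - f mod \<chi>)"
    by (intro valuation_diff_ge[OF v] KP_remainder_ge[OF v key deg]) simp
  also have "f - f mod \<chi> = (f div \<chi>) * \<chi>"
    by (simp add: minus_mod_eq_div_mult)
  also have "\<rho> ((f div \<chi>) * \<chi>) \<le> \<rho> (f div \<chi>) + Fin b"
    unfolding valuation_mult[OF v] using b by (rule add_left_mono)
  also have "\<dots> \<le> \<rho> (exp_coeff \<chi> f (Suc s)) + Fin (nmult s b) + Fin b"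
    using Suc[of "f div \<chi>"] by (intro add_right_mono) (simp add: exp_coeff_Suc)
  finally show ?case by (simp add: add.assoc)
qed

lemma augmentation_increases:
  assumes v: "is_valuation \<rho>" and key: "\<chi> \<in> KP \<rho>" and deg: "degree \<chi> > 0"
    and b: "\<rho> \<chi> \<le> Fin \<beta>"
  shows "\<rho> f \<le> augmentation \<rho> \<chi> \<beta> f"
  by (rule augmentation_ge) (rule KP_expansion_ge[OF v key deg b])


section \<open>Natural multiples in an ordered group\<close>

lemma eventually_ex: "\<forall>\<^sub>F i in sequentially. P i \<Longrightarrow> \<exists>i\<ge>1. P i"
  unfolding eventually_sequentially by (meson nat_le_linear)

lemma nmult_add: "nmult n (a + b) = nmult n a + nmult n b"
  by (induction n) (simp_all add: ac_simps)

lemma nmult_mono: "a \<le> b \<Longrightarrow> nmult n a \<le> nmult n (b :: 'v::linordered_ab_group_add)"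
  by (induction n) (simp_all add: add_mono)

lemma nmult_nonneg: "0 \<le> a \<Longrightarrow> 0 \<le> nmult n (a :: 'v::linordered_ab_group_add)"
  by (induction n) simp_all

lemma nmult_left_mono:
  fixes a :: "'v::linordered_ab_group_add"
  assumes "0 \<le> a" "k \<le> n"
  shows "nmult k a \<le> nmult n a"
  using \<open>k \<le> n\<close>
proof (induction n rule: dec_induct)
  case (step n)
  then show ?case using \<open>0 \<le> a\<close> by (simp add: add_increasing2)
qed simp

lemma nmult_in_value_group: "a \<in> value_group \<nu> \<Longrightarrow> nmult n a \<in> value_group \<nu>"
  by (induction n) (auto simp: value_group_def intro: group_closure_add)


section \<open>Hasse derivatives and the set of maximizing orders\<close>

text \<open>The coefficient of \<open>y ^ b\<close> in \<open>a + (x + y) * p (x + y)\<close>.\<close>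

lemma hasse_pCons:
  "hasse b (pCons a p) = (if b = 0 then [:a:] else hasse (b - 1) p) + pCons 0 (hasse b p)"
  by (cases b) (simp_all add: hasse_def map_poly_pCons pcompose_pCons coeff_pCons)

lemma coeff_hasse: "coeff (hasse b f) k = of_nat ((k + b) choose b) * coeff f (k + b)"
proof (induction f arbitrary: b k)
  case 0
  show ?case by (simp add: hasse_def)
next
  case (pCons a p)
  show ?case
  proof (cases b; cases k)
    fix b' k' assume "b = Suc b'" "k = Suc k'"
    then show ?thesis by (simp add: hasse_pCons pCons.IH algebra_simps)
  qed (simp_all add: hasse_pCons pCons.IH)
qed

lemma hasse_1: "hasse 1 f = pderiv f"
  by (intro poly_eqI) (simp add: coeff_hasse coeff_pderiv)

lemma hasse_eq_0: "degree f < b \<Longrightarrow> hasse b f = 0"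
  by (intro poly_eqI) (simp add: coeff_hasse coeff_eq_0)

lemma degree_hasse_le: "degree (hasse b f) \<le> degree f - b"
  by (intro degree_le) (auto simp: coeff_hasse coeff_eq_0)

lemma hull_frac_less_iff:
  "m > 0 \<Longrightarrow> n > 0 \<Longrightarrow> hull_frac a m < hull_frac b n \<longleftrightarrow> nmult n a < nmult m b"
  by (metis hull_frac_le_iff linorder_not_less)

lemma I_set_eqI:
  assumes "finite (eps_indices \<nu> f)" "b \<in> eps_indices \<nu> f"
    and "\<And>c. c \<in> eps_indices \<nu> f \<Longrightarrow> c \<noteq> b \<Longrightarrow> eps_quot \<nu> f c < eps_quot \<nu> f b"
  shows "I_set \<nu> f = {b}"
proof -
  have "eps \<nu> f = eps_quot \<nu> f b"
    unfolding eps_def using assms by (intro Max_eqI) (auto intro: less_imp_le)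
  then show ?thesis using assms by (force simp: I_set_def)
qed


section \<open>The structure of a continuous chain\<close>

locale continuous_MacLane_chain =
  fixes \<rho> :: "nat \<Rightarrow> 'k::field poly \<Rightarrow> 'v::linordered_ab_group_add extended"
    and \<chi> :: "nat \<Rightarrow> 'k poly" and \<beta> :: "nat \<Rightarrow> 'v" and m :: nat
  assumes chain: "continuous_chain \<rho> \<chi> \<beta> m"
begin

lemma val: "is_valuation (\<rho> i)"
  using chain by (simp add: continuous_chain_def)

lemma key: "\<chi> (Suc i) \<in> KP (\<rho> i)"
  using chain unfolding continuous_chain_def by (metis diff_Suc_1 le_add1 plus_1_eq_Suc)

lemma key_less: "\<rho> i (\<chi> (Suc i)) < Fin (\<beta> (Suc i))"
  using chain unfolding continuous_chain_def by (metis diff_Suc_1 le_add1 plus_1_eq_Suc)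

lemma augment: "\<rho> (Suc i) = augmentation (\<rho> i) (\<chi> (Suc i)) (\<beta> (Suc i))"
  using chain unfolding continuous_chain_def by (metis diff_Suc_1 le_add1 plus_1_eq_Suc)

lemma degree_key: "1 \<le> i \<Longrightarrow> degree (\<chi> i) = m"
  using chain unfolding continuous_chain_def by blast

lemma not_dvd: "1 \<le> i \<Longrightarrow> \<not> val_dvd (\<rho> i) (\<chi> (Suc i)) (\<chi> i)"
  using chain unfolding continuous_chain_def by (metis Suc_eq_plus1)

lemma monic_key: "1 \<le> i \<Longrightarrow> lead_coeff (\<chi> i) = 1"
  using key[of "i - 1"] by (simp add: KP_def)

text \<open>A monic polynomial of degree \<open>0\<close> is \<open>1\<close>; then consecutive key polynomials would
  coincide and divide each other.\<close>

lemma m_pos: "0 < m"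
proof (rule ccontr)
  assume "\<not> 0 < m"
  then have "\<chi> i = 1" if "1 \<le> i" for i
    using that degree_key[of i] monic_key[of i] degree_0_id[of "\<chi> i"]
    by (simp add: one_pCons)
  then have "val_dvd (\<rho> 1) (\<chi> (Suc 1)) (\<chi> 1)"
    by (intro val_dvd_if_close[OF val, of _ _ _ 1])
      (simp add: is_valuation_0[OF val] is_valuation_1[OF val])
  then show False using not_dvd[of 1] by simp
qed

lemma degree_key_pos: "1 \<le> i \<Longrightarrow> 0 < degree (\<chi> i)"
  using degree_key m_pos by simp

lemma value_key: "1 \<le> i \<Longrightarrow> \<rho> i (\<chi> i) = Fin (\<beta> i)"
  using augmentation_at_key[OF val degree_key_pos] augment by (cases i) auto

lemma value_low_degree: "degree a < m \<Longrightarrow> \<rho> i a = \<rho> j a"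
proof -
  assume a: "degree a < m"
  have "\<rho> i a = \<rho> 0 a" for i
    using augmentation_low_degree[OF val] a by (induction i) (simp_all add: augment degree_key)
  then show ?thesis by metis
qed

lemma value_mono: "i \<le> j \<Longrightarrow> \<rho> i f \<le> \<rho> j f"
proof (induction j rule: dec_induct)
  case (step j)
  have "\<rho> j f \<le> \<rho> (Suc j) f"
    unfolding augment[of j]
    by (intro augmentation_increases val key degree_key_pos less_imp_le[OF key_less]) simp
  with step show ?case by (meson order_trans)
qed simp

lemma value_low_degree_finite: "a \<noteq> 0 \<Longrightarrow> degree a < m \<Longrightarrow> \<rho> i a \<noteq> Pinf"
  using KP_low_degree_finite[OF val key, of a i] degree_key[of "Suc i"] by simp

lemma value_le_term:
  "1 \<le> i \<Longrightarrow> \<rho> i f \<le> \<rho> i (exp_coeff (\<chi> i) f s) + Fin (nmult s (\<beta> i))"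
  using augmentation_le[OF val, of "\<chi> i" "i - 1" "\<beta> i" f s]
    value_low_degree[of "exp_coeff (\<chi> i) f s" i "i - 1"] augment[of "i - 1"]
    degree_key[of i] degree_key_pos[of i] exp_coeff_degree[of "\<chi> i" f s]
  by simp

lemma value_finite:
  assumes "1 \<le> i" "f \<noteq> 0"
  obtains a where "\<rho> i f = Fin a"
proof -
  obtain s where s: "exp_coeff (\<chi> i) f s \<noteq> 0"
    using exp_coeff_expansion[OF degree_key_pos[OF assms(1)], of f] assms(2)
    by (metis (no_types, lifting) mult_zero_left sum.neutral)
  have "degree (exp_coeff (\<chi> i) f s) < m"
    using exp_coeff_degree[OF degree_key_pos[OF assms(1)]] degree_key[OF assms(1)] by simp
  from value_low_degree_finite[OF s this, of i] have "\<rho> i f \<noteq> Pinf"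
    using value_le_term[OF assms(1), of f s] valuation_not_Minf[OF val]
    by (cases "\<rho> i (exp_coeff (\<chi> i) f s)") auto
  then show ?thesis
    using that valuation_not_Minf[OF val] by (metis extended.exhaust)
qed

lemma degree_key_diff: "1 \<le> i \<Longrightarrow> 1 \<le> j \<Longrightarrow> degree (\<chi> i - \<chi> j) < m"
proof -
  assume ij: "1 \<le> i" "1 \<le> j"
  have "degree (\<chi> i - \<chi> j) \<le> m"
    using ij by (intro degree_diff_le) (simp_all add: degree_key)
  moreover have "coeff (\<chi> i - \<chi> j) m = 0"
    using ij monic_key degree_key by (metis cancel_comm_monoid_add_class.diff_cancel coeff_diff)
  ultimately show ?thesis
    using m_pos by (metis degree_0 le_neq_implies_less leading_coeff_0_iff)
qed

text \<open>Both strict inequalities between the values of \<open>\<chi> i\<close> and of \<open>a = \<chi> (i + 1) - \<chi> i\<close> are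
  impossible. If \<open>a\<close> has the larger value, then \<open>\<chi> (i + 1)\<close> and \<open>\<chi> i\<close> have the same initial
  form, against \<open>not_dvd\<close>. If \<open>a\<close> has the smaller value, then \<open>\<chi> (i + 1)\<close> has the initial
  form of \<open>a\<close>, whose degree is too small for a multiple of a key polynomial. Since \<open>a\<close> has
  degree less than \<open>m\<close>, this also puts \<open>\<beta> i\<close> into the stable value group.\<close>

lemma value_key_step:
  assumes "1 \<le> i"
  shows "\<rho> i (\<chi> (Suc i) - \<chi> i) = Fin (\<beta> i)"
proof -
  let ?a = "\<chi> (Suc i) - \<chi> i"
  have "\<not> \<rho> i (\<chi> i) < \<rho> i ?a"
  proof
    assume "\<rho> i (\<chi> i) < \<rho> i ?a"
    then have "\<rho> i (\<chi> i) < \<rho> i (\<chi> i - \<chi> (Suc i) * 1)"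
      using is_valuation_minus[OF val, of i ?a] by simp
    then have "val_dvd (\<rho> i) (\<chi> (Suc i)) (\<chi> i)"
      by (intro val_dvd_if_close[OF val] disjI2)
    with not_dvd[OF assms] show False ..
  qed
  moreover have "\<not> \<rho> i ?a < \<rho> i (\<chi> i)"
  proof
    assume less: "\<rho> i ?a < \<rho> i (\<chi> i)"
    then have "\<rho> i ?a < \<rho> i (?a - \<chi> (Suc i) * 1)"
      using is_valuation_minus[OF val, of i "\<chi> i"] by simp
    then have "val_dvd (\<rho> i) (\<chi> (Suc i)) ?a"
      by (intro val_dvd_if_close[OF val] disjI2)
    moreover have "?a \<noteq> 0" using less by (auto simp: is_valuation_0[OF val])
    moreover have "degree ?a < degree (\<chi> (Suc i))"
      using degree_key_diff[of "Suc i" i] degree_key[of "Suc i"] assms by simp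
    ultimately show False using key[of i] by (auto simp: KP_def)
  qed
  ultimately show ?thesis using value_key[OF assms] by simp
qed

lemma \<beta>_step: "1 \<le> i \<Longrightarrow> \<beta> i < \<beta> (Suc i)"
proof -
  assume i: "1 \<le> i"
  have "Fin (\<beta> i) \<le> \<rho> i (\<chi> i + (\<chi> (Suc i) - \<chi> i))"
    using i by (intro valuation_add_ge[OF val]) (simp_all only: value_key value_key_step order_refl)
  also have "\<dots> < Fin (\<beta> (Suc i))" using key_less[of i] by simp
  finally show ?thesis by simp
qed

lemma \<beta>_mono: "1 \<le> i \<Longrightarrow> i \<le> j \<Longrightarrow> \<beta> i \<le> \<beta> j"
proof (induction j)
  case (Suc j)
  then show ?case using \<beta>_step[of j] by (cases "i = Suc j") auto
qed simp

lemma value_key_ge: "1 \<le> i \<Longrightarrow> Fin (\<beta> 1) \<le> \<rho> 1 (\<chi> i)"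
proof (induction i rule: dec_induct)
  case base
  then show ?case by (simp add: value_key)
next
  case (step i)
  have "\<rho> 1 (\<chi> (Suc i) - \<chi> i) = Fin (\<beta> i)"
    using value_key_step[of i] value_low_degree[OF degree_key_diff, of "Suc i" i 1 i] step by simp
  then have "Fin (\<beta> 1) \<le> \<rho> 1 (\<chi> i + (\<chi> (Suc i) - \<chi> i))"
    using step \<beta>_mono[of 1 i] by (intro valuation_add_ge[OF val]) simp_all
  then show ?case by simp
qed

text \<open>The top coefficient of the \<open>\<chi> 1\<close>-expansion of \<open>f\<close> is \<open>1\<close>, and \<open>\<rho> 1 f\<close> is at most the
  value of the corresponding term.\<close>

lemma monic_value_le:
  assumes "lead_coeff f = 1" "degree f = k * m"
  shows "\<rho> 1 f \<le> Fin (nmult k (\<beta> 1))"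
  using value_le_term[of 1 f k] exp_coeff_monic_top[of f "\<chi> 1" k] assms
    degree_key[of 1] degree_key_pos[of 1] monic_key[of 1]
  by (simp add: is_valuation_1[OF val])

abbreviation \<Gamma> :: "'v set" where "\<Gamma> \<equiv> stable_value_group \<rho>"

lemma \<Gamma>_0: "0 \<in> \<Gamma>"
  and \<Gamma>_add: "a \<in> \<Gamma> \<Longrightarrow> b \<in> \<Gamma> \<Longrightarrow> a + b \<in> \<Gamma>"
  and \<Gamma>_diff: "a \<in> \<Gamma> \<Longrightarrow> b \<in> \<Gamma> \<Longrightarrow> a - b \<in> \<Gamma>"
  and \<Gamma>_nmult: "a \<in> \<Gamma> \<Longrightarrow> nmult n a \<in> \<Gamma>"
  and \<Gamma>_max: "a \<in> \<Gamma> \<Longrightarrow> b \<in> \<Gamma> \<Longrightarrow> max a b \<in> \<Gamma>"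
  by (auto simp: stable_value_group_def nmult_in_value_group max_def)
    (auto simp: value_group_def intro: group_closure_add group_closure.diff)

lemma \<Gamma>_value: "\<rho> 1 f = Fin a \<Longrightarrow> a \<in> \<Gamma>"
  unfolding stable_value_group_def by (rule value_in_value_group)

lemma \<Gamma>_\<beta>: "1 \<le> i \<Longrightarrow> \<beta> i \<in> \<Gamma>"
  using value_key_step[of i] value_low_degree[OF degree_key_diff, of "Suc i" i 1 i]
  by (intro \<Gamma>_value[of "\<chi> (Suc i) - \<chi> i"]) simp


section \<open>Bounds for coefficients and derivatives\<close>

text \<open>A monic \<open>g\<close> of degree \<open>n\<close> satisfies \<open>m * \<rho> 1 g \<le> n * \<beta> 1\<close>, by the preceding bound for
  \<open>g ^ m\<close>, whose degree is a multiple of \<open>m\<close>. Hence the value of \<open>f\<close> exceeds that of its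
  leading coefficient by at most a constant that depends only on the degree. The cruder
  constant \<open>n * max 0 (\<beta> 1)\<close> avoids division by \<open>m\<close>.\<close>

lemma lead_coeff_value_ge:
  assumes "f \<noteq> 0" and ge: "Fin \<gamma> \<le> \<rho> 1 f"
  shows "Fin (\<gamma> - nmult (degree f) (max 0 (\<beta> 1))) \<le> \<rho> 1 [:lead_coeff f:]"
proof -
  define n where "n = degree f"
  define g where "g = smult (inverse (lead_coeff f)) f"
  define b where "b = nmult n (max 0 (\<beta> 1))"
  have g: "g \<noteq> 0" "lead_coeff g = 1" "degree g = n"
    using \<open>f \<noteq> 0\<close> by (simp_all add: g_def n_def)
  have f: "f = [:lead_coeff f:] * g"
    using \<open>f \<noteq> 0\<close> by (simp add: g_def)
  obtain w where w: "\<rho> 1 g = Fin w"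
    using value_finite[of 1 g] g by auto
  have "\<rho> 1 (g ^ m) \<le> Fin (nmult n (\<beta> 1))"
  proof (rule monic_value_le)
    show "lead_coeff (g ^ m) = 1" using g by (simp only: lead_coeff_power power_one)
    show "degree (g ^ m) = n * m" using g by (simp add: degree_power_eq)
  qed
  then have "nmult m w \<le> nmult n (\<beta> 1)"
    by (simp only: valuation_power[OF val w] less_eq_extended.simps)
  also have "\<dots> \<le> nmult 1 b"
    by (simp add: b_def nmult_mono)
  also have "\<dots> \<le> nmult m b"
    using m_pos by (intro nmult_left_mono) (simp_all add: b_def nmult_nonneg)
  finally have "w \<le> b" using nmult_le_iff[OF m_pos] by blast
  then have "\<rho> 1 g \<le> Fin b" by (simp only: w less_eq_extended.simps)
  then show ?thesis
    using le_valuation_cancel[OF val, of 1 g b \<gamma> "[:lead_coeff f:]"] ge f by (simp add: b_def n_def)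
qed

text \<open>Once the leading term is controlled, it can be subtracted at the cost of a constant,
  and the remaining coefficients follow by induction on the degree. In other words, in
  bounded degree \<open>\<rho> 1\<close> and the minimum of the values of the coefficients differ by a bounded
  amount.\<close>

lemma coeff_value_ge:
  "\<exists>C\<in>\<Gamma>. \<forall>f \<gamma> k. degree f < n \<longrightarrow> Fin \<gamma> \<le> \<rho> 1 f \<longrightarrow> Fin (\<gamma> - C) \<le> \<rho> 1 [:coeff f k:]"
proof (induction n)
  case 0
  show ?case using \<Gamma>_0 by auto
next
  case (Suc n)
  then obtain C where C: "C \<in> \<Gamma>" and
    IH: "\<And>f \<gamma> k. degree f < n \<Longrightarrow> Fin \<gamma> \<le> \<rho> 1 f \<Longrightarrow> Fin (\<gamma> - C) \<le> \<rho> 1 [:coeff f k:]"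
    by blast
  obtain X where X: "\<rho> 1 (monom 1 n) = Fin X"
    using value_finite[of 1 "monom 1 n"] by (auto simp: monom_eq_0_iff)
  define b where "b = nmult n (max 0 (\<beta> 1))"
  define D where "D = max 0 (b - X)"
  have b: "b \<in> \<Gamma>" and D: "D \<in> \<Gamma>"
    by (auto simp: b_def D_def intro!: \<Gamma>_nmult \<Gamma>_max \<Gamma>_0 \<Gamma>_diff \<Gamma>_\<beta> \<Gamma>_value[OF X])
  have "Fin (\<gamma> - max b (D + C)) \<le> \<rho> 1 [:coeff f k:]"
    if deg: "degree f < Suc n" and ge: "Fin \<gamma> \<le> \<rho> 1 f" for f \<gamma> k
  proof -
    let ?c = "coeff f n" and ?g = "f - monom (coeff f n) n"
    have top: "Fin (\<gamma> - b) \<le> \<rho> 1 [:?c:]"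
    proof (cases "f \<noteq> 0 \<and> degree f = n")
      case True
      then show ?thesis using lead_coeff_value_ge[of f \<gamma>] ge by (simp add: b_def)
    next
      case False
      then have "?c = 0" using deg by (auto intro: coeff_eq_0)
      then show ?thesis by (simp add: is_valuation_0[OF val])
    qed
    have "Fin (\<gamma> - b + X) \<le> \<rho> 1 ([:?c:] * monom 1 n)"
      using top X by (intro Fin_mult_ge[OF val]) simp_all
    also have "[:?c:] * monom 1 n = monom ?c n"
      by (simp add: smult_monom)
    finally have "Fin (\<gamma> - b + X) \<le> \<rho> 1 (monom ?c n)" .
    moreover have "b - X \<le> D" "0 \<le> D" by (simp_all add: D_def)
    then have "\<gamma> - D \<le> \<gamma> - b + X" "\<gamma> - D \<le> \<gamma>"
      by (simp_all add: algebra_simps)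
    ultimately have g_ge: "Fin (\<gamma> - D) \<le> \<rho> 1 ?g"
      using ge by (intro valuation_diff_ge[OF val]) (metis less_eq_extended.simps(1) order_trans)+
    show ?thesis
    proof (cases "k = n \<or> ?g = 0")
      case True
      have "\<gamma> - max b (D + C) \<le> \<gamma> - b" by simp
      moreover have "coeff f k = 0" if "k \<noteq> n"
        using that True by (metis coeff_monom eq_iff_diff_eq_0)
      ultimately show ?thesis
        using top by (cases "k = n") (auto simp: is_valuation_0[OF val] intro: order_trans[of _ "Fin (\<gamma> - b)"])
    next
      case False
      have "degree ?g \<le> n"
        using deg by (intro degree_diff_le) (simp_all add: degree_monom_le)
      moreover have "coeff ?g n = 0" by simp
      ultimately have "degree ?g < n"
        using False by (metis le_neq_implies_less leading_coeff_0_iff)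
      from IH[OF this g_ge, of k] have "Fin (\<gamma> - (D + C)) \<le> \<rho> 1 [:coeff f k:]"
        using False by (simp add: algebra_simps)
      moreover have "\<gamma> - max b (D + C) \<le> \<gamma> - (D + C)"
        by (rule diff_left_mono) simp
      ultimately show ?thesis by (meson less_eq_extended.simps(1) order_trans)
    qed
  qed
  moreover have "max b (D + C) \<in> \<Gamma>" by (intro \<Gamma>_max \<Gamma>_add b C D)
  ultimately show ?case by blast
qed

lemma common_lower_bound:
  assumes "\<And>k. h k \<noteq> 0"
  shows "\<exists>E\<in>\<Gamma>. \<forall>k<(n::nat). Fin E \<le> \<rho> 1 (h k)"
proof (induction n)
  case 0
  show ?case using \<Gamma>_0 by auto
next
  case (Suc n)
  then obtain E where E: "E \<in> \<Gamma>" "\<And>k. k < n \<Longrightarrow> Fin E \<le> \<rho> 1 (h k)" by blast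
  obtain X where X: "\<rho> 1 (h n) = Fin X" using value_finite[of 1 "h n"] assms by auto
  show ?case
  proof (intro bexI allI impI)
    show "min E X \<in> \<Gamma>"
      using E(1) \<Gamma>_value[OF X] by (simp add: min_def)
    fix k assume "k < Suc n"
    then show "Fin (min E X) \<le> \<rho> 1 (h k)"
      using E(2)[of k] X \<open>k < Suc n\<close> by (cases "k = n") (auto intro: order_trans[of _ "Fin E"])
  qed
qed

text \<open>Hasse derivatives multiply coefficients by integers, which have non-negative value; so
  they lower values by a bounded amount only.\<close>

lemma hasse_value_ge:
  "\<exists>C\<in>\<Gamma>. \<forall>f \<gamma> b. degree f < n \<longrightarrow> Fin \<gamma> \<le> \<rho> 1 f \<longrightarrow> Fin (\<gamma> - C) \<le> \<rho> 1 (hasse b f)"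
proof -
  obtain C where C: "C \<in> \<Gamma>" and
    coeff: "\<And>f \<gamma> k. degree f < n \<Longrightarrow> Fin \<gamma> \<le> \<rho> 1 f \<Longrightarrow> Fin (\<gamma> - C) \<le> \<rho> 1 [:coeff f k:]"
    using coeff_value_ge[of n] by blast
  obtain E where E: "E \<in> \<Gamma>" "\<And>k. k < n \<Longrightarrow> Fin E \<le> \<rho> 1 (monom 1 k)"
    using common_lower_bound[of "monom 1" n] by (auto simp: monom_eq_0_iff)
  have "Fin (\<gamma> - (C - E)) \<le> \<rho> 1 (hasse b f)"
    if deg: "degree f < n" and ge: "Fin \<gamma> \<le> \<rho> 1 f" for f \<gamma> b
  proof -
    let ?h = "hasse b f"
    have "Fin (\<gamma> - (C - E)) \<le> \<rho> 1 (\<Sum>k\<le>degree ?h. monom (coeff ?h k) k)"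
    proof (rule valuation_sum_ge[OF val])
      fix k assume "k \<in> {..degree ?h}"
      then have "k < n" using degree_hasse_le[of b f] deg by simp
      have "Fin ((\<gamma> - C) + (0 + E)) \<le> \<rho> 1 ([:coeff f (k + b):] * (of_nat ((k + b) choose b) * monom 1 k))"
        by (intro Fin_mult_ge[OF val] coeff[OF deg ge] valuation_of_nat_ge[OF val] E(2)[OF \<open>k < n\<close>])
      also have "[:coeff f (k + b):] * (of_nat ((k + b) choose b) * monom 1 k) = monom (coeff ?h k) k"
        by (simp add: coeff_hasse of_nat_poly smult_monom mult.commute)
      finally show "Fin (\<gamma> - (C - E)) \<le> \<rho> 1 (monom (coeff ?h k) k)"
        by (simp add: algebra_simps)
    qed
    then show ?thesis by (simp only: poly_as_sum_of_monoms)
  qed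
  with \<Gamma>_diff[OF C E(1)] show ?thesis by blast
qed


section \<open>Expansions at the key polynomials and non-stable polynomials\<close>

lemma remainder_value_ge:
  assumes "1 \<le> i"
  shows "\<rho> i f \<le> \<rho> i (f mod \<chi> i)"
  using value_le_term[OF assms, of f 0]
  by (cases "\<rho> i (f mod \<chi> i)") (simp_all add: exp_coeff_0)

lemma degree_remainder: "1 \<le> i \<Longrightarrow> degree (f mod \<chi> i) < m"
  using exp_coeff_degree[OF degree_key_pos, of i f 0] by (simp add: exp_coeff_0 degree_key)

text \<open>The loss \<open>\<beta> 1\<close> is independent of \<open>i\<close>. Therefore all coefficients of all \<open>\<chi>
  i\<close>-expansions of a polynomial are bounded below uniformly in \<open>i\<close>.\<close>

lemma quotient_value_ge:
  assumes i: "1 \<le> i" and ge: "Fin \<gamma> \<le> \<rho> 1 f"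
  shows "Fin (\<gamma> - \<beta> 1) \<le> \<rho> 1 (f div \<chi> i)"
proof (rule le_valuation_cancel[OF val])
  show "\<rho> 1 (\<chi> i) \<le> Fin (\<beta> 1)"
    using monic_value_le[of "\<chi> i" 1] monic_key[OF i] degree_key[OF i] by simp
  have "\<rho> 1 f \<le> \<rho> 1 (f mod \<chi> i)"
    using value_mono[OF i, of f] remainder_value_ge[OF i, of f]
      value_low_degree[OF degree_remainder[OF i, of f], of i 1] by simp
  then have "Fin \<gamma> \<le> \<rho> 1 (f - f mod \<chi> i)"
    using ge by (intro valuation_diff_ge[OF val]) simp_all
  then show "Fin \<gamma> \<le> \<rho> 1 (f div \<chi> i * \<chi> i)"
    by (simp add: minus_mod_eq_div_mult)
qed

lemma exp_coeff_value_ge: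
  assumes i: "1 \<le> i"
  shows "Fin \<gamma> \<le> \<rho> 1 f \<Longrightarrow> Fin (\<gamma> - nmult s (\<beta> 1)) \<le> \<rho> i (exp_coeff (\<chi> i) f s)"
proof (induction s arbitrary: f \<gamma>)
  case 0
  then show ?case
    using value_mono[OF i, of f] remainder_value_ge[OF i, of f] by (simp add: exp_coeff_0)
next
  case (Suc s)
  show ?case
    using Suc.IH[OF quotient_value_ge[OF i Suc.prems]] by (simp add: exp_coeff_Suc algebra_simps)
qed

text \<open>A value of \<open>\<rho> i\<close> is attained by a term of the \<open>\<chi> i\<close>-expansion, and \<open>\<rho> i\<close> and \<open>\<rho> 1\<close>
  agree on the coefficient of that term.\<close>

lemma \<Gamma>_value_stage:
  assumes i: "1 \<le> i" and f: "\<rho> i f = Fin a"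
  shows "a \<in> \<Gamma>"
proof -
  obtain n where n: "i = Suc n" using i by (cases i) auto
  have "\<rho> i f \<in> (\<lambda>s. \<rho> n (exp_coeff (\<chi> i) f s) + Fin (nmult s (\<beta> i))) ` {..degree f}"
    unfolding n augment augmentation_def by (intro Min_in) auto
  then obtain s where s: "Fin a = \<rho> n (exp_coeff (\<chi> i) f s) + Fin (nmult s (\<beta> i))"
    using f by auto
  then obtain c where c: "\<rho> n (exp_coeff (\<chi> i) f s) = Fin c" "a = c + nmult s (\<beta> i)"
    by (cases "\<rho> n (exp_coeff (\<chi> i) f s)") auto
  have "degree (exp_coeff (\<chi> i) f s) < m"
    using exp_coeff_degree[OF degree_key_pos[OF i]] degree_key[OF i] by simp
  then have "c \<in> \<Gamma>"
    using c(1) value_low_degree[of "exp_coeff (\<chi> i) f s" 1 n] by (intro \<Gamma>_value) simp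
  then show ?thesis unfolding c(2) by (intro \<Gamma>_add \<Gamma>_nmult \<Gamma>_\<beta>[OF i])
qed

text \<open>Write \<open>f = r + p\<close> with \<open>r = f mod \<chi> i\<close>. If \<open>r\<close> had a smaller value than \<open>p\<close> at stage
  \<open>i\<close>, this would persist at all later stages, because the value of \<open>r\<close> does not change and
  that of \<open>p\<close> can only grow; then \<open>f\<close> would be stable with the value of \<open>r\<close>. So the multiple
  \<open>p\<close> of \<open>\<chi> i\<close> bounds the values of both \<open>r\<close> and \<open>f\<close> from below, and its value grows with \<open>\<beta>
  i\<close>.\<close>

lemma non_stable_value_ge:
  assumes unst: "\<not> stable \<rho> f" and i: "1 \<le> i" and ge: "Fin \<gamma> \<le> \<rho> 1 f"
  shows "Fin (\<gamma> - \<beta> 1 + \<beta> i) \<le> \<rho> i (f mod \<chi> i)" and "Fin (\<gamma> - \<beta> 1 + \<beta> i) \<le> \<rho> i f"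
    and "\<rho> i (f div \<chi> i * \<chi> i) \<le> \<rho> i f"
proof -
  let ?r = "f mod \<chi> i" and ?p = "f div \<chi> i * \<chi> i"
  have "\<not> \<rho> i ?r < \<rho> i ?p"
  proof
    assume less: "\<rho> i ?r < \<rho> i ?p"
    have "\<rho> j f = \<rho> i ?r" if "i \<le> j" for j
    proof -
      have r: "\<rho> j ?r = \<rho> i ?r" by (rule value_low_degree[OF degree_remainder[OF i]])
      then have "\<rho> j ?r < \<rho> j ?p" using less value_mono[OF that, of ?p] by simp
      then have "\<rho> j (?r + ?p) = \<rho> j ?r" by (rule valuation_add_eq[OF val])
      then show ?thesis by (simp add: r)
    qed
    then have "stable \<rho> f" unfolding stable_def eventually_sequentially by blast
    with unst show False ..
  qed
  then have le: "\<rho> i ?p \<le> \<rho> i ?r" by simp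
  have "Fin (\<gamma> - \<beta> 1) \<le> \<rho> i (f div \<chi> i)"
    using quotient_value_ge[OF i ge] value_mono[OF i] order_trans by blast
  then have p: "Fin (\<gamma> - \<beta> 1 + \<beta> i) \<le> \<rho> i ?p"
    by (intro Fin_mult_ge[OF val]) (simp_all add: value_key[OF i])
  then show "Fin (\<gamma> - \<beta> 1 + \<beta> i) \<le> \<rho> i ?r" using le by (rule order_trans)
  have "\<rho> i ?p \<le> \<rho> i (?p + ?r)" by (intro valuation_add_ge[OF val] le order_refl)
  then show "\<rho> i ?p \<le> \<rho> i f" by simp
  with p show "Fin (\<gamma> - \<beta> 1 + \<beta> i) \<le> \<rho> i f" by (rule order_trans)
qed


section \<open>Valuations above the chain\<close>

text \<open>By induction on the degree of \<open>a\<close>, using the division \<open>\<chi> 1 = r + q * a\<close>. All of \<open>a\<close>,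
  \<open>q\<close>, \<open>r\<close> keep their values from \<open>\<rho> 0\<close> to \<open>\<rho> 1\<close>, while the value of \<open>\<chi> 1\<close> increases. So \<open>r\<close>
  and \<open>q * a\<close> must have equal values that cancel in the sum. Above the chain the value of \<open>\<chi>
  1\<close> remains too large to interfere, so \<open>q * a\<close> still has the value of \<open>r\<close>, which is known
  by induction. As neither factor can lose value, neither can gain any. A constant \<open>a\<close>
  starts the induction, with its inverse in the role of \<open>q\<close>.\<close>

lemma valuation_above_low_degree:
  assumes nu: "is_valuation \<nu>" and above: "\<And>i f. \<rho> i f \<le> \<nu> f"
  shows "a \<noteq> 0 \<Longrightarrow> degree a < m \<Longrightarrow> \<nu> a = \<rho> 1 a"
proof (induction "degree a" arbitrary: a rule: less_induct)
  case less
  have cancel: "\<nu> a = \<rho> 1 a" if eq: "\<nu> (b * a) = \<rho> 1 (b * a)" and "b \<noteq> 0" for b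
  proof -
    obtain x where x: "\<rho> 1 a = Fin x" by (rule value_finite[OF order_refl less.prems(1)])
    obtain y where y: "\<rho> 1 b = Fin y" by (rule value_finite[OF order_refl \<open>b \<noteq> 0\<close>])
    from x y have sum: "\<nu> b + \<nu> a = Fin (y + x)"
      using eq by (simp add: valuation_mult[OF nu] valuation_mult[OF val])
    then obtain x' y' where x': "\<nu> a = Fin x'" and y': "\<nu> b = Fin y'"
      by (cases "\<nu> a"; cases "\<nu> b") auto
    have "x \<le> x'" "y \<le> y'" "y' + x' = y + x"
      using above[of 1 a] above[of 1 b] sum x y x' y' by simp_all
    then have "x' = x"
      by (metis add_le_cancel_left add_mono_thms_linordered_semiring(3) order_antisym)
    then show ?thesis using x x' by simp
  qed
  show ?case
  proof (cases "degree a = 0")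
    case True
    then obtain c where c: "a = [:c:]" by (metis degree_eq_zeroE)
    then have "[:inverse c:] * a = 1" using less.prems by (simp add: one_pCons)
    then show ?thesis
      using cancel[of "[:inverse c:]"] less.prems c
      by (simp only: is_valuation_1[OF nu] is_valuation_1[OF val]) simp
  next
    case False
    let ?q = "\<chi> 1 div a" and ?r = "\<chi> 1 mod a"
    have r: "degree ?r < degree a"
      using exp_coeff_degree[of a "\<chi> 1" 0] False by (simp add: exp_coeff_0)
    have eq: "?r + ?q * a = \<chi> 1" by simp
    have less1: "\<rho> 0 (\<chi> 1) < \<rho> 1 (\<chi> 1)"
      using key_less[of 0] value_key[of 1] by simp
    have q: "?q \<noteq> 0" "degree ?q < m"
    proof -
      have "degree ?r < degree (\<chi> 1)" using r less.prems degree_key[of 1] by simp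
      then show "?q \<noteq> 0" using eq by (metis add.right_neutral less_irrefl mult_zero_left)
      have "degree (?q * a) = degree (\<chi> 1 - ?r)" by (simp add: minus_mod_eq_div_mult)
      also have "\<dots> = m"
        using \<open>degree ?r < degree (\<chi> 1)\<close> degree_add_eq_left[of "- ?r" "\<chi> 1"] degree_key[of 1]
        by simp
      finally show "degree ?q < m"
        using \<open>?q \<noteq> 0\<close> less.prems False by (simp add: degree_mult_eq)
    qed
    have qa: "\<rho> 1 (?q * a) = \<rho> 0 (?q * a)"
      using value_low_degree[of ?q 1 0] value_low_degree[of a 1 0] q less.prems
      by (simp add: valuation_mult[OF val])
    have r01: "\<rho> 1 ?r = \<rho> 0 ?r"
      using r less.prems by (intro value_low_degree) simp
    \<comment> \<open>If the values differed, the smaller one would be the value of \<open>\<chi> 1\<close> at both stages.\<close>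
    have "\<not> \<rho> 1 ?r < \<rho> 1 (?q * a)"
    proof
      assume *: "\<rho> 1 ?r < \<rho> 1 (?q * a)"
      then have "\<rho> 0 (?r + ?q * a) = \<rho> 0 ?r" "\<rho> 1 (?r + ?q * a) = \<rho> 1 ?r"
        by (simp_all only: valuation_add_eq[OF val] qa r01)
      then show False using less1 r01 by (simp only: eq)
    qed
    moreover have "\<not> \<rho> 1 (?q * a) < \<rho> 1 ?r"
    proof
      assume *: "\<rho> 1 (?q * a) < \<rho> 1 ?r"
      then have "\<rho> 0 (?q * a + ?r) = \<rho> 0 (?q * a)" "\<rho> 1 (?q * a + ?r) = \<rho> 1 (?q * a)"
        by (simp_all only: valuation_add_eq[OF val] qa r01)
      then show False using less1 qa by (simp only: eq add.commute)
    qed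
    ultimately have same: "\<rho> 1 (?q * a) = \<rho> 1 ?r" by simp
    have "\<rho> 0 ?r \<le> \<rho> 0 (?r + ?q * a)"
      using same qa r01 by (intro valuation_add_ge[OF val]) simp_all
    then have small: "\<rho> 1 ?r < \<rho> 1 (\<chi> 1)"
      using less1 r01 by (simp only: eq)
    then have "?r \<noteq> 0" by (auto simp: is_valuation_0[OF val])
    then have nur: "\<nu> ?r = \<rho> 1 ?r" using less.hyps[OF r] r less.prems by simp
    have "\<nu> (- ?r + \<chi> 1) = \<nu> (- ?r)"
      using small nur above[of 1 "\<chi> 1"]
      by (intro valuation_add_eq[OF nu]) (simp add: is_valuation_minus[OF nu])
    moreover have "- ?r + \<chi> 1 = ?q * a" by (metis add.commute eq minus_add_cancel)
    ultimately have "\<nu> (?q * a) = \<rho> 1 (?q * a)"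
      using nur same by (simp add: is_valuation_minus[OF nu])
    then show ?thesis using cancel q by blast
  qed
qed

lemma valuation_above_key:
  assumes nu: "is_valuation \<nu>" and above: "\<And>i f. \<rho> i f \<le> \<nu> f" and i: "1 \<le> i"
  shows "\<nu> (\<chi> i) = Fin (\<beta> i)"
proof -
  let ?a = "\<chi> (Suc i) - \<chi> i"
  have a: "\<rho> i ?a = Fin (\<beta> i)" by (rule value_key_step[OF i])
  then have "?a \<noteq> 0" by (auto simp: is_valuation_0[OF val])
  moreover have deg: "degree ?a < m" using i by (intro degree_key_diff) simp_all
  ultimately have "\<nu> ?a = Fin (\<beta> i)"
    using valuation_above_low_degree[OF nu above] a value_low_degree[OF deg, of i 1] by simp
  moreover have "Fin (\<beta> i) < \<nu> (\<chi> (Suc i))"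
    using above[of "Suc i" "\<chi> (Suc i)"] value_key[of "Suc i"] \<beta>_step[OF i]
    by (metis le_add1 less_extended_simps(1) less_le_trans plus_1_eq_Suc)
  ultimately have "\<nu> (- ?a + \<chi> (Suc i)) = Fin (\<beta> i)"
    using valuation_add_eq[OF nu, of "- ?a" "\<chi> (Suc i)"]
    by (simp only: is_valuation_minus[OF nu])
  then show ?thesis by simp
qed

end


section \<open>The limit valuation of an unbounded chain\<close>

locale unbounded_MacLane_chain = continuous_MacLane_chain \<rho> \<chi> \<beta> m
  for \<rho> :: "nat \<Rightarrow> 'k::field poly \<Rightarrow> 'v::linordered_ab_group_add extended"
    and \<chi> :: "nat \<Rightarrow> 'k poly" and \<beta> :: "nat \<Rightarrow> 'v" and m :: nat +
  assumes unbounded: "\<not> (\<exists>\<gamma>\<in>stable_value_group \<rho>. \<forall>i\<ge>1. \<beta> i \<le> \<gamma>)"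
begin

lemma eventually_\<beta>_gt:
  assumes "\<gamma> \<in> \<Gamma>"
  shows "\<forall>\<^sub>F i in sequentially. 1 \<le> i \<and> \<gamma> < \<beta> i"
proof -
  obtain i where "1 \<le> i" "\<gamma> < \<beta> i" using unbounded assms by (meson linorder_not_less)
  then have "1 \<le> j \<and> \<gamma> < \<beta> j" if "i \<le> j" for j
    using that \<beta>_mono[of i j] by (auto intro: less_le_trans)
  then show ?thesis unfolding eventually_sequentially by blast
qed

lemma stable_value:
  assumes "stable \<rho> f" "f \<noteq> 0"
  obtains c where "c \<in> \<Gamma>" "\<forall>\<^sub>F i in sequentially. \<rho> i f = Fin c"
proof -
  obtain x where x: "\<forall>\<^sub>F i in sequentially. \<rho> i f = x"
    using assms(1) by (auto simp: stable_def)
  then obtain i where i: "1 \<le> i" "\<rho> i f = x"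
    using eventually_conj[OF x eventually_ge_at_top[of 1]] eventually_happens'[OF sequentially_bot]
    by fastforce
  obtain c where c: "\<rho> i f = Fin c" by (rule value_finite[OF i(1) assms(2)])
  show ?thesis
    by (rule that[of c]) (use \<Gamma>_value_stage[OF i(1) c] x i c in simp_all)
qed

lemma non_stable_unbounded:
  assumes unst: "\<not> stable \<rho> f" and \<gamma>: "\<gamma> \<in> \<Gamma>"
  shows "\<forall>\<^sub>F i in sequentially. Fin \<gamma> < \<rho> i f"
proof -
  have "f \<noteq> 0" using unst by (auto simp: stable_def is_valuation_0[OF val])
  then obtain c where c: "\<rho> 1 f = Fin c" by (rule value_finite[OF order_refl])
  have "\<gamma> - c + \<beta> 1 \<in> \<Gamma>"
    by (intro \<Gamma>_add \<Gamma>_diff \<gamma> \<Gamma>_value[OF c] \<Gamma>_\<beta>) simp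
  from eventually_\<beta>_gt[OF this] show ?thesis
  proof eventually_elim
    case (elim i)
    have "\<gamma> < c - \<beta> 1 + \<beta> i"
      using elim by (metis add_diff_eq diff_add_eq diff_less_eq less_diff_eq add.commute diff_diff_eq2)
    then have "Fin \<gamma> < Fin (c - \<beta> 1 + \<beta> i)" by simp
    also have "\<dots> \<le> \<rho> i f"
      using elim c by (intro non_stable_value_ge(2)[OF unst]) simp_all
    finally show ?case .
  qed
qed

text \<open>The pointwise limit, which is \<open>\<infinity>\<close> on non-stable polynomials. It shows that valuations
  above the chain exist, with values in the given group; without such a valuation the
  condition that describes \<open>b_infty\<close> would hold for every positive integer.\<close>

definition limit_valuation :: "'k poly \<Rightarrow> 'v extended" where
  "limit_valuation f =
     (if \<exists>c. \<forall>\<^sub>F i in sequentially. \<rho> i f = Fin c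
      then Fin (SOME c. \<forall>\<^sub>F i in sequentially. \<rho> i f = Fin c) else Pinf)"

lemma limit_valuation_Fin:
  "limit_valuation f = Fin c \<longleftrightarrow> (\<forall>\<^sub>F i in sequentially. \<rho> i f = Fin c)"
proof
  assume lim: "limit_valuation f = Fin c"
  have ex: "\<exists>c. \<forall>\<^sub>F i in sequentially. \<rho> i f = Fin c"
  proof (rule ccontr)
    assume "\<nexists>c. \<forall>\<^sub>F i in sequentially. \<rho> i f = Fin c"
    then show False using lim by (simp add: limit_valuation_def)
  qed
  with lim have "(SOME c. \<forall>\<^sub>F i in sequentially. \<rho> i f = Fin c) = c"
    by (simp add: limit_valuation_def)
  with someI_ex[OF ex] show "\<forall>\<^sub>F i in sequentially. \<rho> i f = Fin c"
    by simp
next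
  assume c: "\<forall>\<^sub>F i in sequentially. \<rho> i f = Fin c"
  have "d = c" if d: "\<forall>\<^sub>F i in sequentially. \<rho> i f = Fin d" for d
  proof -
    obtain i where "\<rho> i f = Fin c" "\<rho> i f = Fin d"
      using eventually_ex[OF eventually_conj[OF c d]] by blast
    then show ?thesis by (metis extended.inject)
  qed
  with c have "(SOME c. \<forall>\<^sub>F i in sequentially. \<rho> i f = Fin c) = c"
    by (rule some_equality)
  moreover have "\<exists>c. \<forall>\<^sub>F i in sequentially. \<rho> i f = Fin c" using c by (rule exI)
  ultimately show "limit_valuation f = Fin c"
    by (simp only: limit_valuation_def if_True)
qed

text \<open>Unboundedness of the chain makes the value \<open>\<infinity>\<close> a genuine limit. This is the reason why
  sums of polynomials of value \<open>\<infinity>\<close> have value \<open>\<infinity>\<close> again.\<close>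

lemma limit_valuation_Pinf:
  "limit_valuation f = Pinf \<longleftrightarrow> (\<forall>\<gamma>\<in>\<Gamma>. \<forall>\<^sub>F i in sequentially. Fin \<gamma> < \<rho> i f)"
proof
  assume inf: "limit_valuation f = Pinf"
  show "\<forall>\<gamma>\<in>\<Gamma>. \<forall>\<^sub>F i in sequentially. Fin \<gamma> < \<rho> i f"
  proof (cases "stable \<rho> f")
    case True
    have "f = 0"
    proof (rule ccontr)
      assume "f \<noteq> 0"
      then obtain c where "\<forall>\<^sub>F i in sequentially. \<rho> i f = Fin c"
        using stable_value[OF True] by blast
      then show False using inf limit_valuation_Fin[of f c] by simp
    qed
    then show ?thesis by (simp add: is_valuation_0[OF val])
  qed (blast intro: non_stable_unbounded)
next
  assume *: "\<forall>\<gamma>\<in>\<Gamma>. \<forall>\<^sub>F i in sequentially. Fin \<gamma> < \<rho> i f"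
  show "limit_valuation f = Pinf"
  proof (cases "limit_valuation f")
    case (Fin c)
    then have c: "\<forall>\<^sub>F i in sequentially. \<rho> i f = Fin c" by (simp add: limit_valuation_Fin)
    then obtain i where "1 \<le> i" "\<rho> i f = Fin c" using eventually_ex by blast
    then have "c \<in> \<Gamma>" by (rule \<Gamma>_value_stage)
    then have "\<forall>\<^sub>F i in sequentially. Fin c < \<rho> i f" using * by blast
    from eventually_ex[OF eventually_conj[OF this c]] show ?thesis by auto
  qed (auto simp: limit_valuation_def split: if_splits)
qed

lemma limit_valuation_ge: "\<rho> i f \<le> limit_valuation f"
proof (cases "limit_valuation f")
  case (Fin c)
  then have "\<forall>\<^sub>F j in sequentially. \<rho> j f = Fin c \<and> i \<le> j"
    by (simp add: limit_valuation_Fin eventually_conj eventually_ge_at_top)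
  then obtain j where "\<rho> j f = Fin c" "i \<le> j" using eventually_ex by blast
  then show ?thesis using value_mono[of i j f] Fin by simp
qed (auto simp: limit_valuation_def split: if_splits)

lemma limit_valuation_not_Minf: "limit_valuation f \<noteq> Minf"
  by (simp add: limit_valuation_def)

lemma limit_valuation_mult_inf:
  assumes "limit_valuation f = Pinf"
  shows "limit_valuation (f * g) = Pinf"
proof (cases "g = 0")
  case True
  then show ?thesis by (simp add: limit_valuation_Pinf is_valuation_0[OF val])
next
  case False
  then obtain c where c: "\<rho> 1 g = Fin c" by (rule value_finite[OF order_refl])
  show ?thesis
    unfolding limit_valuation_Pinf
  proof
    fix \<gamma> assume "\<gamma> \<in> \<Gamma>"
    then have "\<gamma> - c \<in> \<Gamma>" by (intro \<Gamma>_diff \<Gamma>_value[OF c])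
    with assms have "\<forall>\<^sub>F i in sequentially. Fin (\<gamma> - c) < \<rho> i f"
      by (simp add: limit_valuation_Pinf)
    then show "\<forall>\<^sub>F i in sequentially. Fin \<gamma> < \<rho> i (f * g)"
      using eventually_ge_at_top[of 1]
    proof eventually_elim
      case (elim i)
      have "Fin c \<le> \<rho> i g" using value_mono[OF elim(2), of g] c by simp
      then show ?case
        using elim(1) unfolding valuation_mult[OF val]
        by (cases "\<rho> i f"; cases "\<rho> i g")
          (auto simp: diff_less_eq intro: less_le_trans add_left_mono)
    qed
  qed
qed

lemma is_valuation_limit: "is_valuation limit_valuation"
  unfolding is_valuation_def
proof (intro conjI allI)
  fix f g :: "'k poly" and c :: 'k
  show "limit_valuation f \<noteq> Minf" by (rule limit_valuation_not_Minf)
  show "limit_valuation (f * g) = limit_valuation f + limit_valuation g"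
  proof (cases "limit_valuation f = Pinf \<or> limit_valuation g = Pinf")
    case True
    then have "limit_valuation (f * g) = Pinf"
      using limit_valuation_mult_inf by (metis mult.commute)
    with True limit_valuation_not_Minf[of f] limit_valuation_not_Minf[of g] show ?thesis
      by (cases "limit_valuation f"; cases "limit_valuation g") auto
  next
    case False
    then obtain a b where ab: "limit_valuation f = Fin a" "limit_valuation g = Fin b"
      using limit_valuation_not_Minf by (metis extended.exhaust)
    then have "\<forall>\<^sub>F i in sequentially. \<rho> i f = Fin a \<and> \<rho> i g = Fin b"
      by (simp add: limit_valuation_Fin eventually_conj)
    then have "\<forall>\<^sub>F i in sequentially. \<rho> i (f * g) = Fin (a + b)"
      by eventually_elim (simp add: valuation_mult[OF val])
    then show ?thesis by (simp add: ab flip: limit_valuation_Fin)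
  qed
  show "min (limit_valuation f) (limit_valuation g) \<le> limit_valuation (f + g)"
  proof (cases "limit_valuation (f + g)")
    case (Fin c)
    then have "\<forall>\<^sub>F i in sequentially. \<rho> i (f + g) = Fin c" by (simp add: limit_valuation_Fin)
    then have \<rho>: "\<forall>\<^sub>F i in sequentially. \<not> (Fin c < \<rho> i f \<and> Fin c < \<rho> i g)"
    proof eventually_elim
      case (elim i)
      then show ?case
        using valuation_diff_gt[OF val, of "Fin c" i f "- g"] is_valuation_minus[OF val, of i g]
        by auto
    qed
    have c: "c \<in> \<Gamma>"
      using eventually_ex[of "\<lambda>i. \<rho> i (f + g) = Fin c"] Fin \<Gamma>_value_stage
      by (auto simp: limit_valuation_Fin)
    have ev: "\<forall>\<^sub>F i in sequentially. Fin c < \<rho> i h" if "Fin c < limit_valuation h" for h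
    proof (cases "limit_valuation h")
      case (Fin d)
      then have "\<forall>\<^sub>F i in sequentially. \<rho> i h = Fin d" by (simp add: limit_valuation_Fin)
      then show ?thesis by eventually_elim (use that Fin in simp)
    next
      case Pinf
      then show ?thesis using c by (simp add: limit_valuation_Pinf)
    qed (use that in simp)
    have "\<not> (Fin c < limit_valuation f \<and> Fin c < limit_valuation g)"
      using eventually_ex[OF eventually_conj[OF \<rho> eventually_conj[OF ev ev]]] by auto
    then show ?thesis unfolding Fin by (auto simp: min_le_iff_disj not_less)
  qed (auto simp: limit_valuation_not_Minf)
  show "limit_valuation [:c:] = Pinf \<longleftrightarrow> c = 0"
  proof (cases "c = 0")
    case True
    then show ?thesis by (simp add: limit_valuation_Pinf is_valuation_0[OF val])
  next
    case False
    then obtain a where "\<rho> 1 [:c:] = Fin a"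
      using value_finite[of 1 "[:c:]"] by auto
    then have "\<rho> i [:c:] = Fin a" for i
      using value_low_degree[of "[:c:]" i 1] m_pos by simp
    then have "limit_valuation [:c:] = Fin a" by (simp add: limit_valuation_Fin)
    with False show ?thesis by simp
  qed
qed

lemma limit_valuation_greater: "limit_valuation > \<rho> i"
proof -
  have "\<rho> i \<le> limit_valuation" by (simp add: le_fun_def limit_valuation_ge)
  moreover have "\<rho> i (\<chi> (Suc i)) < limit_valuation (\<chi> (Suc i))"
    using key_less[of i] limit_valuation_ge[of "Suc i" "\<chi> (Suc i)"] value_key[of "Suc i"]
    by simp
  ultimately show ?thesis by (metis less_irrefl order_le_imp_less_or_eq)
qed

end


section \<open>The invariants in characteristic zero\<close>

locale unbounded_MacLane_chain_char_0 = unbounded_MacLane_chain \<rho> \<chi> \<beta> m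
  for \<rho> :: "nat \<Rightarrow> 'k::field_char_0 poly \<Rightarrow> 'v::linordered_ab_group_add extended"
    and \<chi> :: "nat \<Rightarrow> 'k poly" and \<beta> :: "nat \<Rightarrow> 'v" and m :: nat
begin

text \<open>In characteristic zero the derivative of \<open>\<chi> i\<close> has degree \<open>m - 1\<close> and leading
  coefficient \<open>m\<close>, for every \<open>i\<close>. A bound on the leading coefficient bounds the polynomial.\<close>

lemma pderiv_key_bounded:
  obtains U where "U \<in> \<Gamma>" "\<And>i. 1 \<le> i \<Longrightarrow> \<rho> 1 (pderiv (\<chi> i)) \<le> Fin U"
proof -
  have "(of_nat m :: 'k) \<noteq> 0" using m_pos by simp
  then obtain w where w: "\<rho> 1 [:of_nat m:] = Fin w"
    using value_finite[of 1 "[:of_nat m :: 'k:]"] by auto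
  define B where "B = nmult (m - 1) (max 0 (\<beta> 1))"
  have "\<rho> 1 (pderiv (\<chi> i)) \<le> Fin (w + B)" if i: "1 \<le> i" for i
  proof -
    let ?d = "pderiv (\<chi> i)"
    have deg: "degree ?d = m - 1" using degree_key[OF i] by (simp add: degree_pderiv)
    have lead: "lead_coeff ?d = of_nat m"
      using m_pos monic_key[OF i] degree_key[OF i] by (simp add: deg coeff_pderiv)
    then have "?d \<noteq> 0" using m_pos by auto
    then obtain x where x: "\<rho> 1 ?d = Fin x" by (rule value_finite[OF order_refl])
    have "Fin (x - B) \<le> Fin w"
      using lead_coeff_value_ge[OF \<open>?d \<noteq> 0\<close>, of x, unfolded lead, unfolded deg] x w
      unfolding B_def by simp
    then show ?thesis by (simp only: x less_eq_extended.simps diff_le_eq)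
  qed
  moreover have "w + B \<in> \<Gamma>"
    by (auto simp: B_def intro!: \<Gamma>_add \<Gamma>_nmult \<Gamma>_max \<Gamma>_0 \<Gamma>_\<beta> \<Gamma>_value[OF w])
  ultimately show ?thesis using that by blast
qed

lemma hasse_key_bounded_below:
  obtains L where "L \<in> \<Gamma>" "\<And>i b. 1 \<le> i \<Longrightarrow> Fin L \<le> \<rho> 1 (hasse b (\<chi> i))"
proof -
  obtain C where C: "C \<in> \<Gamma>" and
    ge: "\<And>f \<gamma> b. degree f < Suc m \<Longrightarrow> Fin \<gamma> \<le> \<rho> 1 f \<Longrightarrow> Fin (\<gamma> - C) \<le> \<rho> 1 (hasse b f)"
    using hasse_value_ge[of "Suc m"] by blast
  show ?thesis
  proof (rule that)
    show "\<beta> 1 - C \<in> \<Gamma>" by (intro \<Gamma>_diff C \<Gamma>_\<beta>) simp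
    show "Fin (\<beta> 1 - C) \<le> \<rho> 1 (hasse b (\<chi> i))" if "1 \<le> i" for i b
      using value_key_ge[OF that] degree_key[OF that] by (intro ge) simp_all
  qed
qed

text \<open>Let \<open>u\<close> and \<open>c\<close> be the values of the derivatives of \<open>\<chi> j\<close> of order \<open>1\<close> and \<open>b \<ge> 2\<close>.
  The claim \<open>(\<beta> j - c) / b < \<beta> j - u\<close> follows from \<open>\<beta> j - c < 2 * (\<beta> j - u)\<close> when \<open>\<beta> j \<ge> u\<close>,
  that is, from \<open>\<beta> j > 2 * u - c\<close>. As \<open>u\<close> is bounded above and \<open>c\<close> below, both conditions
  hold for large \<open>j\<close>.\<close>

lemma eventually_I_set:
  assumes nu: "is_valuation \<nu>" and above: "\<And>i. \<nu> > \<rho> i"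
  shows "\<forall>\<^sub>F j in sequentially. I_set \<nu> (\<chi> j) = {1}"
proof -
  have ge: "\<rho> i f \<le> \<nu> f" for i f
    using less_imp_le[OF above[of i]] by (rule le_funD)
  obtain U where U: "U \<in> \<Gamma>" "\<And>i. 1 \<le> i \<Longrightarrow> \<rho> 1 (pderiv (\<chi> i)) \<le> Fin U"
    using pderiv_key_bounded by blast
  obtain L where L: "L \<in> \<Gamma>" "\<And>i b. 1 \<le> i \<Longrightarrow> Fin L \<le> \<rho> 1 (hasse b (\<chi> i))"
    using hasse_key_bounded_below by blast
  have "max U (U + U - L) \<in> \<Gamma>" by (intro \<Gamma>_max \<Gamma>_diff \<Gamma>_add U L)
  from eventually_\<beta>_gt[OF this] show ?thesis
  proof eventually_elim
    case (elim j)
    then have j: "1 \<le> j" "U < \<beta> j" "U + U - L < \<beta> j" by simp_all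
    have deg: "degree (hasse b (\<chi> j)) < m" if "1 \<le> b" for b
      using degree_hasse_le[of b "\<chi> j"] degree_key[OF j(1)] m_pos that by simp
    have h: "\<nu> (hasse b (\<chi> j)) = \<rho> 1 (hasse b (\<chi> j))" if "1 \<le> b" for b
      using valuation_above_low_degree[OF nu ge _ deg[OF that]]
      by (cases "hasse b (\<chi> j) = 0") (simp_all add: is_valuation_0[OF nu] is_valuation_0[OF val])
    obtain u where u: "\<rho> 1 (hasse 1 (\<chi> j)) = Fin u" "u \<le> U"
      using U(2)[OF j(1), folded hasse_1] valuation_not_Minf[OF val, of 1]
      by (cases "\<rho> 1 (hasse 1 (\<chi> j))") auto
    have fin: "fin_part (\<nu> (\<chi> j)) = \<beta> j"
      by (simp add: valuation_above_key[OF nu ge j(1)])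
    show ?case
    proof (rule I_set_eqI)
      have "eps_indices \<nu> (\<chi> j) \<subseteq> {..m}"
        using hasse_eq_0[of "\<chi> j"] degree_key[OF j(1)] is_valuation_0[OF nu]
        by (auto simp: eps_indices_def not_less[symmetric])
      then show "finite (eps_indices \<nu> (\<chi> j))" by (rule finite_subset) simp
      show "1 \<in> eps_indices \<nu> (\<chi> j)"
        using h[of 1] u by (simp add: eps_indices_def)
      fix b assume b: "b \<in> eps_indices \<nu> (\<chi> j)" "b \<noteq> 1"
      then have "2 \<le> b" by (auto simp: eps_indices_def)
      then have "Fin L \<le> \<nu> (hasse b (\<chi> j))" using h[of b] L(2)[OF j(1), of b] by simp
      then obtain c where c: "\<nu> (hasse b (\<chi> j)) = Fin c" "L \<le> c"
        using b by (cases "\<nu> (hasse b (\<chi> j))") (auto simp: eps_indices_def)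
      have "\<beta> j - c < (\<beta> j - u) + (\<beta> j - u)"
      proof -
        have "U + U < \<beta> j + L" using j(3) by (simp add: diff_less_eq)
        have "u + u \<le> U + U" using u(2) by (simp add: add_mono)
        also have "\<dots> < \<beta> j + L" by fact
        also have "\<dots> \<le> \<beta> j + c" using c(2) by simp
        finally have "u + u < \<beta> j + c" .
        then show ?thesis by (simp add: algebra_simps)
      qed
      also have "(\<beta> j - u) + (\<beta> j - u) = nmult 2 (\<beta> j - u)"
        by (simp add: numeral_2_eq_2)
      also have "\<dots> \<le> nmult b (\<beta> j - u)"
        using j(2) u(2) \<open>2 \<le> b\<close> by (intro nmult_left_mono) simp_all
      finally show "eps_quot \<nu> (\<chi> j) b < eps_quot \<nu> (\<chi> j) 1"
        using \<open>2 \<le> b\<close> h[of 1] u(1) unfolding eps_quot_def fin c(1)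
        by (subst hull_frac_less_iff) simp_all
    qed
  qed
qed

lemma b_infty_eq_1: "b_infty \<rho> \<chi> = 1"
  unfolding b_infty_def
proof (rule the_equality)
  show "0 < (1::nat) \<and> (\<forall>\<nu>. is_valuation \<nu> \<and> (\<forall>i. \<rho> i < \<nu>) \<longrightarrow>
      (\<forall>\<^sub>F j in sequentially. I_set \<nu> (\<chi> j) = {1}))"
    using eventually_I_set by simp
  fix b
  assume "0 < b \<and> (\<forall>\<nu>. is_valuation \<nu> \<and> (\<forall>i. \<rho> i < \<nu>) \<longrightarrow>
      (\<forall>\<^sub>F j in sequentially. I_set \<nu> (\<chi> j) = {b}))"
  then have "\<forall>\<^sub>F j in sequentially. I_set limit_valuation (\<chi> j) = {b}"
    using is_valuation_limit limit_valuation_greater by blast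
  moreover have "\<forall>\<^sub>F j in sequentially. I_set limit_valuation (\<chi> j) = {1}"
    by (intro eventually_I_set is_valuation_limit limit_valuation_greater)
  ultimately have "\<forall>\<^sub>F j in sequentially. {b} = {1}"
    by eventually_elim simp
  then show "b = 1" using eventually_ex by blast
qed

lemma stable_low_degree: "degree f < m \<Longrightarrow> stable \<rho> f"
  unfolding stable_def
  by (intro exI[of _ "\<rho> 0 f"] always_eventually allI value_low_degree)

lemma degree_non_stable: "\<not> stable \<rho> f \<Longrightarrow> 0 < degree f"
  using stable_low_degree[of f] m_pos by linarith

text \<open>Write \<open>\<phi> = a0 + q1 * \<chi> i\<close> and \<open>q1 = a1 + q2 * \<chi> i\<close>. In the derivative \<open>\<phi>' = a0' + q1'
  * \<chi> i + q1 * \<chi> i'\<close> the values of the first two summands grow with \<open>\<beta> i\<close>, for the first one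
  because \<open>\<phi>\<close> is not stable. But \<open>\<phi>'\<close> is non-zero and stable, so the value of the last
  summand is bounded above, and hence that of \<open>q1\<close>, since the \<open>\<chi> i'\<close> are bounded below. As
  the values of \<open>q2 * \<chi> i\<close> are unbounded too, the value of \<open>a1\<close> is bounded above. All other
  coefficients of the expansion are bounded below, so for large \<open>i\<close> the term with \<open>s = 1\<close>
  has a smaller value than each term with \<open>s \<ge> 2\<close>; and its value is at most that of \<open>a0\<close>,
  because \<open>\<phi>\<close> is not stable.\<close>

lemma eventually_t_char:
  assumes \<phi>: "\<not> stable \<rho> \<phi>" and pderiv: "stable \<rho> (pderiv \<phi>)"
  shows "\<forall>\<^sub>F i in sequentially. t_char \<rho> \<chi> \<phi> i = 1"
proof -
  have "\<phi> \<noteq> 0" using degree_non_stable[OF \<phi>] by auto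
  then obtain g where g: "\<rho> 1 \<phi> = Fin g" by (rule value_finite[OF order_refl])
  have "pderiv \<phi> \<noteq> 0"
    using degree_non_stable[OF \<phi>] by (auto simp: pderiv_eq_0_iff)
  then obtain c where c: "c \<in> \<Gamma>" and ev: "\<forall>\<^sub>F i in sequentially. \<rho> i (pderiv \<phi>) = Fin c"
    using stable_value[OF pderiv] by blast
  \<comment> \<open>A degree bound that covers \<open>\<chi> i\<close> as well as the remainder and the quotient of \<open>\<phi>\<close>.\<close>
  define n where "n = Suc (max m (degree \<phi>))"
  obtain C where C: "C \<in> \<Gamma>" and
    ge: "\<And>f \<gamma> b. degree f < n \<Longrightarrow> Fin \<gamma> \<le> \<rho> 1 f \<Longrightarrow> Fin (\<gamma> - C) \<le> \<rho> 1 (hasse b f)"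
    using hasse_value_ge[of n] by blast
  have ge': "Fin (\<gamma> - C) \<le> \<rho> 1 (pderiv f)"
    if "degree f < n" "Fin \<gamma> \<le> \<rho> 1 f" for f \<gamma>
    using ge[OF that, of 1] by (simp only: hasse_1)
  define b where "b = \<beta> 1"
  have g_in: "g \<in> \<Gamma>" and b_in: "b \<in> \<Gamma>" unfolding b_def by (intro \<Gamma>_value[OF g] \<Gamma>_\<beta> order_refl)+
  \<comment> \<open>The eventual value of \<open>\<phi>'\<close> minus a lower bound for the values of the \<open>\<chi> i'\<close>.\<close>
  define U where "U = c - (b - C)"
  have U_in: "U \<in> \<Gamma>" unfolding U_def by (intro \<Gamma>_diff c b_in C)
  have "c - (g - b - C) \<in> \<Gamma>" "U - (g - (b + b)) \<in> \<Gamma>"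
    by (intro \<Gamma>_diff \<Gamma>_add c g_in b_in C U_in)+
  then have "max (c - (g - b - C)) (U - (g - (b + b))) \<in> \<Gamma>" by (rule \<Gamma>_max)
  from eventually_\<beta>_gt[OF this] ev show ?thesis
  proof eventually_elim
    case (elim i)
    then have i: "1 \<le> i" and big1: "c < g - b - C + \<beta> i" and big2: "U < g - (b + b) + \<beta> i"
      by (simp_all add: algebra_simps)
    let ?a0 = "\<phi> mod \<chi> i" and ?q1 = "\<phi> div \<chi> i"
    let ?a1 = "?q1 mod \<chi> i" and ?q2 = "?q1 div \<chi> i"
    have key_i: "\<rho> i (\<chi> i) = Fin (\<beta> i)" by (rule value_key[OF i])
    have lift: "x \<le> \<rho> i f" if "x \<le> \<rho> 1 f" for x f
      using that value_mono[OF i, of f] by (rule order_trans)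
    have q1: "Fin (g - b) \<le> \<rho> 1 ?q1"
      using quotient_value_ge[OF i, of g \<phi>] g by (simp add: b_def)
    have q2: "Fin (g - (b + b)) \<le> \<rho> 1 ?q2"
      using quotient_value_ge[OF i q1] by (simp add: b_def algebra_simps)
    have a0_i: "Fin (g - b + \<beta> i) \<le> \<rho> i ?a0"
      using non_stable_value_ge(1)[OF \<phi> i, of g] g by (simp add: b_def)
    then have a0: "Fin (g - b + \<beta> i) \<le> \<rho> 1 ?a0"
      using value_low_degree[OF degree_remainder[OF i, of \<phi>], of i 1] by simp
    have "degree ?a0 < n" using degree_remainder[OF i, of \<phi>] by (simp add: n_def)
    from lift[OF ge'[OF this a0]] have d0: "Fin (g - b - C + \<beta> i) \<le> \<rho> i (pderiv ?a0)"
      by (simp add: algebra_simps)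
    have "degree ?q1 < n" using degree_div_less[of \<phi> "\<chi> i"] degree_key_pos[OF i] degree_non_stable[OF \<phi>]
      by (simp add: n_def)
    from lift[OF ge'[OF this q1]]
    have d1: "Fin (g - b - C + \<beta> i) \<le> \<rho> i (pderiv ?q1 * \<chi> i)"
      using key_i by (intro Fin_mult_ge[OF val]) simp_all
    have "degree (\<chi> i) < n" using degree_key[OF i] by (simp add: n_def)
    from lift[OF ge'[OF this value_key_ge[OF i]]]
    have dkey: "Fin (b - C) \<le> \<rho> i (pderiv (\<chi> i))" by (simp add: b_def)
    have q2_i: "Fin (g - (b + b) + \<beta> i) \<le> \<rho> i (?q2 * \<chi> i)"
      using lift[OF q2] key_i by (intro Fin_mult_ge[OF val]) simp_all
    have a1_le: "\<rho> i ?a1 \<le> Fin U"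
    proof (rule ccontr)
      assume "\<not> \<rho> i ?a1 \<le> Fin U"
      then have "Fin U < \<rho> i (?a1 - - (?q2 * \<chi> i))"
        using q2_i big2
        by (intro valuation_diff_gt[OF val])
          (auto simp: is_valuation_minus[OF val] intro: less_le_trans[OF _ q2_i])
      then have *: "Fin U < \<rho> i ?q1" by simp
      have "Fin c < \<rho> i (pderiv (\<chi> i) * ?q1)"
        using * dkey unfolding valuation_mult[OF val] U_def
        by (cases "\<rho> i (pderiv (\<chi> i))"; cases "\<rho> i ?q1")
          (auto simp: diff_less_eq intro: less_le_trans add_left_mono)
      moreover have "Fin c < \<rho> i (pderiv ?a0)" "Fin c < \<rho> i (pderiv ?q1 * \<chi> i)"
        using big1 by (auto intro: less_le_trans[OF _ d0] less_le_trans[OF _ d1])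
      ultimately have "Fin c < \<rho> i (pderiv ?a0 - (- (pderiv ?q1 * \<chi> i) - pderiv (\<chi> i) * ?q1))"
        by (intro valuation_diff_gt[OF val]) (simp_all add: is_valuation_minus[OF val])
      also have "pderiv ?a0 - (- (pderiv ?q1 * \<chi> i) - pderiv (\<chi> i) * ?q1) = pderiv (?a0 + ?q1 * \<chi> i)"
        by (simp only: pderiv_add pderiv_mult) (simp add: algebra_simps)
      also have "?a0 + ?q1 * \<chi> i = \<phi>" by simp
      finally show False using elim by simp
    qed
    then obtain u where u: "\<rho> i ?a1 = Fin u" "u \<le> U"
      using valuation_not_Minf[OF val] by (cases "\<rho> i ?a1") auto
    have "\<rho> i ?a1 < \<rho> i (?q2 * \<chi> i)"
      using u big2 by (intro less_le_trans[OF _ q2_i]) simp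
    then have "\<rho> i (?a1 + ?q2 * \<chi> i) = \<rho> i ?a1" by (rule valuation_add_eq[OF val])
    then have "\<rho> i (?q1 * \<chi> i) = Fin (u + \<beta> i)"
      by (simp add: valuation_mult[OF val] key_i u)
    then have lower: "Fin (u + \<beta> i) \<le> \<rho> i \<phi>"
      using non_stable_value_ge(3)[OF \<phi> i, of g] g by simp
    have summand: "\<rho> i (exp_coeff (\<chi> i) \<phi> s * \<chi> i ^ s)
        = \<rho> i (exp_coeff (\<chi> i) \<phi> s) + Fin (nmult s (\<beta> i))" for s
      by (simp add: valuation_mult[OF val] valuation_power[OF val key_i])
    have "exp_coeff (\<chi> i) \<phi> 1 = ?a1" by (simp add: exp_coeff_Suc exp_coeff_0)
    then have at1: "\<rho> i (exp_coeff (\<chi> i) \<phi> 1 * \<chi> i ^ 1) = Fin (u + \<beta> i)"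
      unfolding summand by (simp add: u)
    have val_phi: "\<rho> i \<phi> = Fin (u + \<beta> i)"
      using lower value_le_term[OF i, of \<phi> 1] at1 unfolding summand by simp
    have high: "Fin (u + \<beta> i) < \<rho> i (exp_coeff (\<chi> i) \<phi> s * \<chi> i ^ s)" if "2 \<le> s" for s
    proof -
      have "nmult 2 (\<beta> i - b) \<le> nmult s (\<beta> i - b)"
        using \<beta>_mono[of 1 i] i that by (intro nmult_left_mono) (simp_all add: b_def)
      then have s: "\<beta> i + \<beta> i - (b + b) \<le> nmult s (\<beta> i - b)"
        by (simp add: numeral_2_eq_2 algebra_simps)
      have split: "nmult s (\<beta> i) = nmult s (\<beta> i - b) + nmult s b"
        by (simp flip: nmult_add)
      have "u + \<beta> i < (g - (b + b) + \<beta> i) + \<beta> i" using u(2) big2 by simp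
      also have "\<dots> = g + (\<beta> i + \<beta> i - (b + b))" by (simp add: algebra_simps)
      also have "\<dots> \<le> g + nmult s (\<beta> i - b)" using s by simp
      also have "\<dots> = g - nmult s b + nmult s (\<beta> i)" unfolding split by simp
      finally have "Fin (u + \<beta> i) < Fin (g - nmult s b) + Fin (nmult s (\<beta> i))" by simp
      also have "\<dots> \<le> \<rho> i (exp_coeff (\<chi> i) \<phi> s) + Fin (nmult s (\<beta> i))"
        using exp_coeff_value_ge[OF i, of g \<phi> s] g unfolding b_def by (intro add_right_mono) simp
      finally show ?thesis by (simp only: summand)
    qed
    let ?S = "{s. \<rho> i (exp_coeff (\<chi> i) \<phi> s * \<chi> i ^ s) = \<rho> i \<phi>}"
    have "s \<le> 1" if "s \<in> ?S" for s
      using that high[of s] val_phi by (cases "2 \<le> s") auto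
    moreover have "1 \<in> ?S" using at1 val_phi by simp
    ultimately show "t_char \<rho> \<chi> \<phi> i = 1"
      unfolding t_char_def by (intro Max_eqI) (auto intro: finite_subset[of _ "{..1}"])
  qed
qed

text \<open>The minimal degree is attained by a non-stable polynomial, and dividing by the leading
  coefficient shifts its values by a constant. This makes the number described by \<open>t_infty\<close>
  unique.\<close>

lemma KP_infty_nonempty:
  assumes "m_infty \<rho> < (\<infinity>::enat)"
  shows "KP_infty \<rho> \<noteq> {}"
proof -
  let ?A = "(\<lambda>f. enat (degree f)) ` {f. \<not> stable \<rho> f}"
  have "?A \<noteq> {}"
  proof
    assume "?A = {}"
    then have "m_infty \<rho> = \<infinity>" unfolding m_infty_def by (simp add: Inf_enat_def)
    with assms show False by simp
  qed
  then have "m_infty \<rho> \<in> ?A"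
    unfolding m_infty_def by (metis Inf_enat_def LeastI_ex ex_in_conv)
  then obtain f where f: "\<not> stable \<rho> f" "enat (degree f) = m_infty \<rho>" by auto
  have "f \<noteq> 0" using f by (auto simp: stable_def is_valuation_0[OF val])
  let ?c = "lead_coeff f" and ?g = "smult (inverse (lead_coeff f)) f"
  have fg: "f = [:?c:] * ?g" using \<open>f \<noteq> 0\<close> by simp
  have "\<not> stable \<rho> ?g"
  proof
    assume "stable \<rho> ?g"
    then obtain x where x: "\<forall>\<^sub>F i in sequentially. \<rho> i ?g = x" unfolding stable_def by blast
    have "\<rho> i [:?c:] = \<rho> 0 [:?c:]" for i
      using m_pos by (intro value_low_degree) simp
    then have "\<rho> i f = \<rho> 0 [:?c:] + \<rho> i ?g" for i
      using fg valuation_mult[OF val, of i "[:?c:]" ?g] by metis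
    with x have "\<forall>\<^sub>F i in sequentially. \<rho> i f = \<rho> 0 [:?c:] + x"
      by (auto elim: eventually_mono)
    then show False using f unfolding stable_def by blast
  qed
  then have "?g \<in> KP_infty \<rho>"
    using f \<open>f \<noteq> 0\<close> by (simp add: KP_infty_def)
  then show ?thesis by blast
qed

lemma t_infty_eq_1:
  assumes fin: "m_infty \<rho> < (\<infinity>::enat)"
  shows "t_infty \<rho> \<chi> = 1"
  unfolding t_infty_def
proof (rule the_equality)
  show one: "\<forall>\<phi>\<in>KP_infty \<rho>. \<forall>\<^sub>F i in sequentially. t_char \<rho> \<chi> \<phi> i = 1"
  proof
    fix \<phi> assume \<phi>: "\<phi> \<in> KP_infty \<rho>"
    have "degree \<phi> \<noteq> 0"
      using \<phi> degree_non_stable[of \<phi>] by (simp add: KP_infty_def)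
    have "stable \<rho> (pderiv \<phi>)"
    proof (rule ccontr)
      assume "\<not> stable \<rho> (pderiv \<phi>)"
      then have "m_infty \<rho> \<le> enat (degree (pderiv \<phi>))"
        unfolding m_infty_def by (intro INF_lower) simp
      then show False
        using \<phi> \<open>degree \<phi> \<noteq> 0\<close>
        by (metis (mono_tags, lifting) KP_infty_def degree_pderiv diff_less enat_ord_simps(1) mem_Collect_eq not_gr_zero not_less zero_less_one)
    qed
    then show "\<forall>\<^sub>F i in sequentially. t_char \<rho> \<chi> \<phi> i = 1"
      using \<phi> by (intro eventually_t_char) (simp_all add: KP_infty_def)
  qed
  fix t assume t: "\<forall>\<phi>\<in>KP_infty \<rho>. \<forall>\<^sub>F i in sequentially. t_char \<rho> \<chi> \<phi> i = t"
  obtain \<phi> where "\<phi> \<in> KP_infty \<rho>" using KP_infty_nonempty[OF fin] by blast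
  with t one have "\<forall>\<^sub>F i in sequentially. t_char \<rho> \<chi> \<phi> i = t \<and> t_char \<rho> \<chi> \<phi> i = 1"
    by (simp add: eventually_conj)
  then show "t = 1" using eventually_ex by blast
qed

end

theorem corollary4p12:
  fixes \<rho> :: "nat \<Rightarrow> 'k::field_char_0 poly \<Rightarrow> 'v::linordered_ab_group_add extended"
    and \<chi> :: "nat \<Rightarrow> 'k poly"
    and \<beta> :: "nat \<Rightarrow> 'v"
    and m :: nat
  assumes "essential_chain \<rho> \<chi> \<beta> m"
    and "\<not> (\<exists>\<gamma>\<in>stable_value_group \<rho>. \<forall>i\<ge>1. \<beta> i \<le> \<gamma>)"
  shows "t_infty \<rho> \<chi> = 1 \<and> b_infty \<rho> \<chi> = 1"
proof -
  interpret unbounded_MacLane_chain_char_0 \<rho> \<chi> \<beta> m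
    using assms by unfold_locales (simp_all add: essential_chain_def)
  show ?thesis
    using t_infty_eq_1 b_infty_eq_1 assms(1) by (simp add: essential_chain_def)
qed

end
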